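(* Let $\hat V$ be an $\omega$-nonstandard model of $ZFC^-$ and let $\lambda<\mathfrak{p}_{\hat V}$ be a cardinal. Let $p(x)=\{\varphi_\alpha(x,a_\alpha):\alpha<\lambda\}$ be a partial type over $\hat V$ (i.e. each $\varphi_\alpha$ is a formula of the language of set theory, $a_\alpha\in\hat V$, and every finite subset of $p(x)$ is realized in $\hat V$). Suppose there is $\hat X\in\hat V$ which is finite in the sense of $\hat V$ such that $\varphi_0(x,a_0)$ is the formula $x\in\hat X$. Then $p(x)$ is realized in $\hat V$.
   Context: $ZFC^-$ denotes $ZFC$ without the powerset axiom, with replacement strengthened to collection and choice strengthened to the well-ordering principle. For a model $\hat V \models ZFC^-$, write $\hat\omega$ for $\omega^{\hat V}$ and $\hat<$ for its order. $\hat V$ is $\omega$-nonstandard if $\hat\omega \neq \omega$. For infinite regular cardinals $\kappa,\theta$, a $(\kappa,\theta)$-cut in a linear order $(L,<)$ is a pair of sequences $(a_\alpha:\alpha<\kappa)$ increasing and $(b_\beta:\beta<\theta)$ decreasing with $a_\alpha<b_\beta$ for all $\alpha,\beta$, such that no $c\in L$ satisfies $a_\alpha<c<b_\beta$ for all $\alpha,\beta$. $\mathfrak{p}_{\hat V}$ is the least value of $\kappa+\theta$ over all pairs $(\kappa,\theta)$ such that $(\hat\omega,\hat<)$ admits a $(\kappa,\theta)$-cut. *)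

theory Defs
  imports Main
begin

datatype form =
    Mem nat nat
  | Eq nat nat
  | Neg form
  | Conj form form
  | Ex nat form

text \<open>Satisfaction in a structure whose universe is the type 'a and whose
  membership relation is E (E x y means "x \<in> y" in the model).\<close>
fun sat :: "('a \<Rightarrow> 'a \<Rightarrow> bool) \<Rightarrow> (nat \<Rightarrow> 'a) \<Rightarrow> form \<Rightarrow> bool" where
  "sat E s (Mem i j) = E (s i) (s j)"
| "sat E s (Eq i j) = (s i = s j)"
| "sat E s (Neg \<phi>) = (\<not> sat E s \<phi>)"
| "sat E s (Conj \<phi> \<psi>) = (sat E s \<phi> \<and> sat E s \<psi>)"
| "sat E s (Ex n \<phi>) = (\<exists>x. sat E (s(n := x)) \<phi>)"

definition is_upair :: "('a \<Rightarrow> 'a \<Rightarrow> bool) \<Rightarrow> 'a \<Rightarrow> 'a \<Rightarrow> 'a \<Rightarrow> bool" where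
  "is_upair E z u v \<longleftrightarrow> (\<forall>w. E w z \<longleftrightarrow> (w = u \<or> w = v))"

definition is_pair :: "('a \<Rightarrow> 'a \<Rightarrow> bool) \<Rightarrow> 'a \<Rightarrow> 'a \<Rightarrow> 'a \<Rightarrow> bool" where
  "is_pair E p u v \<longleftrightarrow> (\<forall>z. E z p \<longleftrightarrow> (is_upair E z u u \<or> is_upair E z u v))"

definition is_empty :: "('a \<Rightarrow> 'a \<Rightarrow> bool) \<Rightarrow> 'a \<Rightarrow> bool" where
  "is_empty E e \<longleftrightarrow> (\<forall>z. \<not> E z e)"

definition is_succ :: "('a \<Rightarrow> 'a \<Rightarrow> bool) \<Rightarrow> 'a \<Rightarrow> 'a \<Rightarrow> bool" where
  "is_succ E y x \<longleftrightarrow> (\<forall>z. E z y \<longleftrightarrow> (E z x \<or> z = x))"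

definition is_inductive :: "('a \<Rightarrow> 'a \<Rightarrow> bool) \<Rightarrow> 'a \<Rightarrow> bool" where
  "is_inductive E a \<longleftrightarrow>
     (\<exists>e. E e a \<and> is_empty E e) \<and> (\<forall>x. E x a \<longrightarrow> (\<exists>y. E y a \<and> is_succ E y x))"

definition rel_of :: "('a \<Rightarrow> 'a \<Rightarrow> bool) \<Rightarrow> 'a \<Rightarrow> 'a \<Rightarrow> 'a \<Rightarrow> bool" where
  "rel_of E r x y \<longleftrightarrow> (\<exists>p. E p r \<and> is_pair E p x y)"

definition internal_wellorder :: "('a \<Rightarrow> 'a \<Rightarrow> bool) \<Rightarrow> 'a \<Rightarrow> 'a \<Rightarrow> bool" where
  "internal_wellorder E r a \<longleftrightarrow>
     (\<forall>p. E p r \<longrightarrow> (\<exists>x y. E x a \<and> E y a \<and> is_pair E p x y)) \<and>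
     (\<forall>x. E x a \<longrightarrow> \<not> rel_of E r x x) \<and>
     (\<forall>x y z. E x a \<and> E y a \<and> E z a \<and> rel_of E r x y \<and> rel_of E r y z \<longrightarrow> rel_of E r x z) \<and>
     (\<forall>x y. E x a \<and> E y a \<longrightarrow> rel_of E r x y \<or> x = y \<or> rel_of E r y x) \<and>
     (\<forall>s. (\<forall>z. E z s \<longrightarrow> E z a) \<and> (\<exists>z. E z s) \<longrightarrow>
          (\<exists>m. E m s \<and> (\<forall>z. E z s \<and> z \<noteq> m \<longrightarrow> rel_of E r m z)))"

definition internal_bij :: "('a \<Rightarrow> 'a \<Rightarrow> bool) \<Rightarrow> 'a \<Rightarrow> 'a \<Rightarrow> 'a \<Rightarrow> bool" where
  "internal_bij E f n X \<longleftrightarrow>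
     (\<forall>p. E p f \<longrightarrow> (\<exists>u v. E u n \<and> E v X \<and> is_pair E p u v)) \<and>
     (\<forall>u. E u n \<longrightarrow> (\<exists>v. rel_of E f u v)) \<and>
     (\<forall>u v v'. rel_of E f u v \<and> rel_of E f u v' \<longrightarrow> v = v') \<and>
     (\<forall>u u' v. rel_of E f u v \<and> rel_of E f u' v \<longrightarrow> u = u') \<and>
     (\<forall>v. E v X \<longrightarrow> (\<exists>u. rel_of E f u v))"

definition ZFC_minus :: "('a \<Rightarrow> 'a \<Rightarrow> bool) \<Rightarrow> bool" where
  "ZFC_minus E \<longleftrightarrow>
     \<comment> \<open>extensionality\<close>
     (\<forall>x y. (\<forall>z. E z x \<longleftrightarrow> E z y) \<longrightarrow> x = y) \<and>
     \<comment> \<open>foundation\<close>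
     (\<forall>x. (\<exists>y. E y x) \<longrightarrow> (\<exists>y. E y x \<and> \<not> (\<exists>z. E z y \<and> E z x))) \<and>
     \<comment> \<open>pairing\<close>
     (\<forall>x y. \<exists>z. E x z \<and> E y z) \<and>
     \<comment> \<open>union\<close>
     (\<forall>x. \<exists>u. \<forall>z. (\<exists>y. E y x \<and> E z y) \<longrightarrow> E z u) \<and>
     \<comment> \<open>infinity\<close>
     (\<exists>a. is_inductive E a) \<and>
     \<comment> \<open>separation schema (variable 0 is the separated variable, the others are parameters)\<close>
     (\<forall>\<phi> s a. \<exists>b. \<forall>z. E z b \<longleftrightarrow> (E z a \<and> sat E (s(0 := z)) \<phi>)) \<and>
     \<comment> \<open>collection schema\<close>
     (\<forall>\<phi> s a. (\<forall>x. E x a \<longrightarrow> (\<exists>y. sat E (s(0 := x, 1 := y)) \<phi>)) \<longrightarrow>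
        (\<exists>b. \<forall>x. E x a \<longrightarrow> (\<exists>y. E y b \<and> sat E (s(0 := x, 1 := y)) \<phi>))) \<and>
     \<comment> \<open>well-ordering principle\<close>
     (\<forall>a. \<exists>r. internal_wellorder E r a)"

text \<open>the elements of omega of the model: those belonging to every inductive set
  (in ZFC^- this is the extension of the set omega of the model); its order is E\<close>
definition omega_hat :: "('a \<Rightarrow> 'a \<Rightarrow> bool) \<Rightarrow> 'a set" where
  "omega_hat E = {z. \<forall>a. is_inductive E a \<longrightarrow> E z a}"

definition omega_nonstandard :: "('a \<Rightarrow> 'a \<Rightarrow> bool) \<Rightarrow> bool" where
  "omega_nonstandard E \<longleftrightarrow>
     \<not> (\<exists>f::nat \<Rightarrow> 'a. bij_betw f UNIV (omega_hat E) \<and> (\<forall>m n. m < n \<longleftrightarrow> E (f m) (f n)))"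

definition internally_finite :: "('a \<Rightarrow> 'a \<Rightarrow> bool) \<Rightarrow> 'a \<Rightarrow> bool" where
  "internally_finite E X \<longleftrightarrow> (\<exists>n \<in> omega_hat E. \<exists>f. internal_bij E f n X)"

text \<open>A (\<kappa>,\<theta>)-cut in (L,lt), the cardinals \<kappa>, \<theta> given as cardinal orders rK, rT
  (the sequences are indexed by Field rK, Field rT ordered by rK, rT).\<close>
definition is_cut :: "'a set \<Rightarrow> ('a \<Rightarrow> 'a \<Rightarrow> bool) \<Rightarrow> 'k rel \<Rightarrow> 't rel \<Rightarrow> bool" where
  "is_cut L lt rK rT \<longleftrightarrow>
     (\<exists>a b. a ` Field rK \<subseteq> L \<and> b ` Field rT \<subseteq> L \<and>
        (\<forall>\<alpha>\<in>Field rK. \<forall>\<beta>\<in>Field rK. (\<alpha>, \<beta>) \<in> rK \<and> \<alpha> \<noteq> \<beta> \<longrightarrow> lt (a \<alpha>) (a \<beta>)) \<and>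
        (\<forall>\<alpha>\<in>Field rT. \<forall>\<beta>\<in>Field rT. (\<alpha>, \<beta>) \<in> rT \<and> \<alpha> \<noteq> \<beta> \<longrightarrow> lt (b \<beta>) (b \<alpha>)) \<and>
        (\<forall>\<alpha>\<in>Field rK. \<forall>\<beta>\<in>Field rT. lt (a \<alpha>) (b \<beta>)) \<and>
        \<not> (\<exists>c\<in>L. \<forall>\<alpha>\<in>Field rK. \<forall>\<beta>\<in>Field rT. lt (a \<alpha>) c \<and> lt c (b \<beta>)))"

text \<open>The cardinal |I| is below p of the model: for every pair of infinite regular cardinals
  (\<kappa>,\<theta>) such that omega-hat admits a (\<kappa>,\<theta>)-cut, |I| < \<kappa> + \<theta>.
  Cardinals of such cuts are at most |omega-hat|, so it suffices to let \<kappa>, \<theta> range over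
  cardinal orders on subsets of the universe 'a of the model.\<close>
definition below_p :: "('a \<Rightarrow> 'a \<Rightarrow> bool) \<Rightarrow> 'i set \<Rightarrow> bool" where
  "below_p E I \<longleftrightarrow>
     (\<forall>(rK::'a rel) (rT::'a rel).
        Card_order rK \<and> Cinfinite rK \<and> regularCard rK \<and>
        Card_order rT \<and> Cinfinite rT \<and> regularCard rT \<and>
        is_cut (omega_hat E) (\<lambda>x y. x \<in> omega_hat E \<and> y \<in> omega_hat E \<and> E x y) rK rT
        \<longrightarrow> (card_of I, BNF_Cardinal_Arithmetic.csum rK rT) \<in> ordLess)"

end

theory Submission
  imports Defs
begin

unbundle cardinal_syntax

text \<open>
  The internally finite set is replaced by a number \<open>n\<close>, and a number \<open>z\<close> of the model is read, by
  its expansion in base \<open>n\<close>, as a branch through the \<open>n\<close>-ary tree. The branches through a node form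
  an interval, so the absence of small cuts in \<open>\<omega>\<close> of the model provides a branch through any short
  chain of nodes. By induction on its cardinality \<open>\<lambda>\<close>, every smaller part of the type is realized;
  one builds a \<open>\<lambda>\<close>-chain of branches \<open>z\<^sub>x\<close> with descending nonstandard heights \<open>k\<^sub>x\<close> such that the digits
  of \<open>z\<^sub>x\<close> between \<open>k\<^sub>x\<close> and \<open>k\<^sub>y\<close> satisfy the \<open>y\<close>-th formula for all \<open>y < x\<close>. At each stage, \<open>z\<close> is
  a common branch of the earlier nodes; as its digits may violate the \<open>y\<close>-th formula below some height
  \<open>m\<^sub>y\<close>, one truncates it at a height above all \<open>m\<^sub>y\<close> and below all \<open>k\<^sub>y\<close>, which again exists because there are
  no small cuts. Truncating once more at the end leaves a digit that realizes the whole type.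
\<close>

section \<open>Definability with parameters\<close>

fun vars :: "form \<Rightarrow> nat set" where
  "vars (Mem i j) = {i, j}"
| "vars (Eq i j) = {i, j}"
| "vars (Neg \<phi>) = vars \<phi>"
| "vars (Conj \<phi> \<psi>) = vars \<phi> \<union> vars \<psi>"
| "vars (Ex n \<phi>) = insert n (vars \<phi>)"

lemma finite_vars: "finite (vars \<phi>)"
  by (induction \<phi>) auto

lemma sat_cong: "(\<And>i. i \<in> vars \<phi> \<Longrightarrow> s i = t i) \<Longrightarrow> sat E s \<phi> = sat E t \<phi>"
proof (induction \<phi> arbitrary: s t)
  case (Neg \<phi>)
  have "sat E s \<phi> = sat E t \<phi>" by (rule Neg.IH) (use Neg.prems in simp)
  then show ?case by simp
next
  case (Conj \<phi> \<psi>)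
  have "sat E s \<phi> = sat E t \<phi>" by (rule Conj.IH(1)) (use Conj.prems in simp)
  moreover have "sat E s \<psi> = sat E t \<psi>" by (rule Conj.IH(2)) (use Conj.prems in simp)
  ultimately show ?case by simp
next
  case (Ex n \<phi>)
  have "sat E (s(n := x)) \<phi> = sat E (t(n := x)) \<phi>" for x
    by (rule Ex.IH) (use Ex.prems in simp)
  then show ?case by simp
qed simp_all

text \<open>The map \<open>\<rho>\<close> may identify variables; capture is avoided by moving each
  bound variable to one outside the image of the variables of the formula.\<close>

lemma sat_rename: "\<exists>\<psi>. \<forall>s. sat E s \<psi> = sat E (\<lambda>i. s (\<rho> i)) \<phi>"
proof (induction \<phi> arbitrary: \<rho>)
  case (Mem i j)
  show ?case by (rule exI[of _ "Mem (\<rho> i) (\<rho> j)"]) simp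
next
  case (Eq i j)
  show ?case by (rule exI[of _ "Eq (\<rho> i) (\<rho> j)"]) simp
next
  case (Neg \<phi>)
  then obtain \<psi> where "\<forall>s. sat E s \<psi> = sat E (\<lambda>i. s (\<rho> i)) \<phi>" by blast
  then show ?case by (intro exI[of _ "Neg \<psi>"]) simp
next
  case (Conj \<phi>1 \<phi>2)
  obtain \<psi>1 where "\<forall>s. sat E s \<psi>1 = sat E (\<lambda>i. s (\<rho> i)) \<phi>1" using Conj.IH(1) by blast
  moreover obtain \<psi>2 where "\<forall>s. sat E s \<psi>2 = sat E (\<lambda>i. s (\<rho> i)) \<phi>2" using Conj.IH(2) by blast
  ultimately show ?case by (intro exI[of _ "Conj \<psi>1 \<psi>2"]) simp
next
  case (Ex n \<phi>)
  have "finite (\<rho> ` vars \<phi>)" using finite_vars by blast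
  then obtain m where m: "m \<notin> \<rho> ` vars \<phi>" using ex_new_if_finite infinite_UNIV_nat by blast
  obtain \<psi> where \<psi>: "\<forall>s. sat E s \<psi> = sat E (\<lambda>i. s ((\<rho>(n := m)) i)) \<phi>" using Ex.IH by blast
  have "sat E (\<lambda>i. (s(m := x)) ((\<rho>(n := m)) i)) \<phi> = sat E ((\<lambda>i. s (\<rho> i))(n := x)) \<phi>" for s x
    by (rule sat_cong) (use m in auto)
  then show ?case using \<psi> by (intro exI[of _ "Ex m \<psi>"]) (simp only: sat.simps simp_thms)
qed

text \<open>Variables live at even positions, parameters at odd ones.\<close>

definition weave :: "(nat \<Rightarrow> 'a) \<Rightarrow> (nat \<Rightarrow> 'a) \<Rightarrow> nat \<Rightarrow> 'a" where
  "weave s c i = (if even i then s (i div 2) else c (i div 2))"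

text \<open>The assignment \<open>s\<close> acts as a de Bruijn context: under a quantifier,
  position 0 is the bound variable and the others are shifted. So definability can be derived along
  the HOL syntax of a predicate.\<close>

definition definable :: "('a \<Rightarrow> 'a \<Rightarrow> bool) \<Rightarrow> ((nat \<Rightarrow> 'a) \<Rightarrow> bool) \<Rightarrow> bool" where
  "definable E P \<longleftrightarrow> (\<exists>\<phi> c. \<forall>s. P s \<longleftrightarrow> sat E (weave s c) \<phi>)"

lemma definableI:
  assumes "\<And>s. P s \<longleftrightarrow> sat E (\<lambda>i. weave s c (\<rho> i)) \<phi>"
  shows "definable E P"
proof -
  obtain \<psi> where "\<forall>s. sat E s \<psi> = sat E (\<lambda>i. s (\<rho> i)) \<phi>" using sat_rename[of E \<rho> \<phi>] by blast
  then show ?thesis unfolding definable_def using assms by (intro exI[of _ \<psi>] exI[of _ c]) simp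
qed

lemma definable_not:
  assumes "definable E P"
  shows "definable E (\<lambda>s. \<not> P s)"
proof -
  obtain \<phi> c where "\<forall>s. P s \<longleftrightarrow> sat E (weave s c) \<phi>" using assms unfolding definable_def by blast
  then show ?thesis unfolding definable_def by (intro exI[of _ "Neg \<phi>"] exI[of _ c]) simp
qed

lemma definable_conj:
  assumes "definable E P" "definable E Q"
  shows "definable E (\<lambda>s. P s \<and> Q s)"
proof -
  obtain \<phi> c where 1: "\<And>s. P s \<longleftrightarrow> sat E (weave s c) \<phi>" using assms unfolding definable_def by blast
  obtain \<psi> d where 2: "\<And>s. Q s \<longleftrightarrow> sat E (weave s d) \<psi>" using assms unfolding definable_def by blast
  \<comment> \<open>The two parameter sequences are interleaved into one: \<open>c\<close> keeps the
    even slots and \<open>d\<close> the odd ones. The renamings below redirect the parameters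
    accordingly and fix the variables.\<close>
  let ?e = "weave c d"
  obtain \<phi>' where 3: "\<And>s. sat E s \<phi>' = sat E (\<lambda>i. s (if even i then i else 2 * i - 1)) \<phi>"
    using sat_rename[of E "\<lambda>i. if even i then i else 2 * i - 1" \<phi>] by blast
  obtain \<psi>' where 4: "\<And>s. sat E s \<psi>' = sat E (\<lambda>i. s (if even i then i else 2 * i + 1)) \<psi>"
    using sat_rename[of E "\<lambda>i. if even i then i else 2 * i + 1" \<psi>] by blast
  have 5: "(\<lambda>i. weave s ?e (if even i then i else 2 * i - 1)) = weave s c" for s
  proof
    show "weave s ?e (if even i then i else 2 * i - 1) = weave s c i" for i
      by (cases "even i") (auto simp: weave_def elim: oddE)
  qed
  have 6: "(\<lambda>i. weave s ?e (if even i then i else 2 * i + 1)) = weave s d" for s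
  proof
    show "weave s ?e (if even i then i else 2 * i + 1) = weave s d i" for i
      by (cases "even i") (auto simp: weave_def elim: oddE)
  qed
  show ?thesis unfolding definable_def
    by (intro exI[of _ "Conj \<phi>' \<psi>'"] exI[of _ ?e]) (simp only: sat.simps 1 2 3 4 5 6 simp_thms)
qed

lemma definable_ex:
  assumes "definable E (\<lambda>s. P (s 0) (\<lambda>i. s (Suc i)))"
  shows "definable E (\<lambda>s. \<exists>x. P x s)"
proof -
  obtain \<phi> c where 1: "\<And>s. P (s 0) (\<lambda>i. s (Suc i)) \<longleftrightarrow> sat E (weave s c) \<phi>"
    using assms unfolding definable_def by blast
  \<comment> \<open>Moving all parameters up by one slot frees position 1 for the bound variable, so
    the variables of \<open>s\<close> stay in place.\<close>
  let ?r = "\<lambda>i. if i = 0 then 1 else if even i then i - 2 else i + 2"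
  let ?c = "\<lambda>i. c (i - 1)"
  obtain \<psi> where 2: "\<And>s. sat E s \<psi> = sat E (\<lambda>i. s (?r i)) \<phi>"
    using sat_rename[of E "?r" \<phi>] by blast
  have 3: "(\<lambda>i. ((weave s ?c)(1 := x)) (?r i)) = weave (case_nat x s) c" for s x
  proof
    fix i
    show "((weave s ?c)(1 := x)) (?r i) = weave (case_nat x s) c i"
    proof (cases "even i")
      case True
      then obtain k where "i = 2 * k" by blast
      then show ?thesis by (cases k) (auto simp: weave_def)
    next
      case False
      then obtain k where "i = 2 * k + 1" using oddE by blast
      then show ?thesis by (auto simp: weave_def)
    qed
  qed
  have "P x s \<longleftrightarrow> sat E (weave (case_nat x s) c) \<phi>" for x s
    using 1[of "case_nat x s"] by simp
  then show ?thesis unfolding definable_def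
    by (intro exI[of _ "Ex 1 \<psi>"] exI[of _ ?c]) (simp only: sat.simps 2 3 simp_thms)
qed

lemma definable_rename:
  assumes "definable E P"
  shows "definable E (\<lambda>s. P (\<lambda>i. s (\<rho> i)))"
proof -
  obtain \<phi> c where 1: "\<And>s. P s \<longleftrightarrow> sat E (weave s c) \<phi>" using assms unfolding definable_def by blast
  have 2: "weave (\<lambda>i. s (\<rho> i)) c = (\<lambda>i. weave s c (if even i then 2 * \<rho> (i div 2) else i))" for s
    by (auto simp: weave_def fun_eq_iff)
  show ?thesis by (rule definableI) (subst 1, subst 2, rule refl)
qed

lemma definable_imp: "definable E P \<Longrightarrow> definable E Q \<Longrightarrow> definable E (\<lambda>s. P s \<longrightarrow> Q s)"
  using definable_not[OF definable_conj[OF _ definable_not], of E P Q] by simp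

lemma definable_disj: "definable E P \<Longrightarrow> definable E Q \<Longrightarrow> definable E (\<lambda>s. P s \<or> Q s)"
  unfolding disj_imp by (intro definable_imp definable_not)

lemma definable_iff: "definable E P \<Longrightarrow> definable E Q \<Longrightarrow> definable E (\<lambda>s. P s \<longleftrightarrow> Q s)"
  unfolding iff_conv_conj_imp by (intro definable_conj definable_imp)

lemma definable_all:
  assumes "definable E (\<lambda>s. P (s 0) (\<lambda>i. s (Suc i)))"
  shows "definable E (\<lambda>s. \<forall>x. P x s)"
  using definable_not[OF definable_ex[where P="\<lambda>x s. \<not> P x s", OF definable_not[OF assms]]] by simp

section \<open>Definable functions and substitution\<close>

definition definable_term :: "('a \<Rightarrow> 'a \<Rightarrow> bool) \<Rightarrow> ((nat \<Rightarrow> 'a) \<Rightarrow> 'a) \<Rightarrow> bool" where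
  "definable_term E t \<longleftrightarrow> definable E (\<lambda>s. s 0 = t (\<lambda>i. s (Suc i)))"

text \<open>A function enters only through its graph: \<open>P (t s) s\<close> is rewritten as
  \<open>\<exists>x. x = t s \<and> P x s\<close>.\<close>

lemma definable_let:
  assumes "definable_term E t" "definable E (\<lambda>s. P (s 0) (\<lambda>i. s (Suc i)))"
  shows "definable E (\<lambda>s. P (t s) s)"
  using definable_ex[where P="\<lambda>x s. x = t s \<and> P x s",
      OF definable_conj[OF assms(1)[unfolded definable_term_def] assms(2)]]
  by simp

lemma definable_term_shift:
  assumes "definable_term E t"
  shows "definable_term E (\<lambda>s. t (\<lambda>i. s (Suc i)))"
  using definable_rename[OF assms[unfolded definable_term_def], of "case_nat 0 (\<lambda>i. Suc (Suc i))"]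
  unfolding definable_term_def by simp

lemma definable_term_var: "definable_term E (\<lambda>s. s i)"
  unfolding definable_term_def
  by (rule definableI[where \<phi>="Eq 0 1" and \<rho>="\<lambda>n. if n = 0 then 0 else 2 * Suc i"])
    (simp add: weave_def)

lemma definable_term_const: "definable_term E (\<lambda>s. c)"
  unfolding definable_term_def
  by (rule definableI[where \<phi>="Eq 0 1" and \<rho>="\<lambda>n. n" and c="\<lambda>_. c"]) (simp add: weave_def)

lemma definable_subst2:
  assumes "definable E (\<lambda>s. P (s 0) (s 1))" "definable_term E t" "definable_term E u"
  shows "definable E (\<lambda>s. P (t s) (u s))"
proof (rule definable_let[OF assms(2)])
  have "definable E (\<lambda>s. P (s 1) (s 0))"
    using definable_rename[OF assms(1), of "\<lambda>i. 1 - i"] by simp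
  then show "definable E (\<lambda>s. P (s 0) (u (\<lambda>i. s (Suc i))))"
    by (intro definable_let[where P="\<lambda>x s. P (s 0) x", OF definable_term_shift[OF assms(3)]]) simp
qed

lemma definable_subst3:
  assumes "definable E (\<lambda>s. P (s 0) (s 1) (s 2))"
    "definable_term E t" "definable_term E u" "definable_term E v"
  shows "definable E (\<lambda>s. P (t s) (u s) (v s))"
proof (rule definable_let[OF assms(2)])
  have "definable E (\<lambda>s. P (s 1) (s 0) (s 2))"
    using definable_rename[OF assms(1), of "(\<lambda>i. i)(0 := 1, 1 := 0)"] by simp
  then have "definable E (\<lambda>s. P (s 1) (s 0) (v (\<lambda>i. s (Suc (Suc i)))))"
    using definable_rename[OF assms(1), of "\<lambda>i. 2 - i"]
    by (intro definable_let[where P="\<lambda>x s. P (s 1) (s 0) x",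
          OF definable_term_shift[OF definable_term_shift[OF assms(4)]]]) (simp add: numeral_2_eq_2)
  then show "definable E (\<lambda>s. P (s 0) (u (\<lambda>i. s (Suc i))) (v (\<lambda>i. s (Suc i))))"
    by (intro definable_let[where P="\<lambda>x s. P (s 0) x (v (\<lambda>i. s (Suc i)))",
          OF definable_term_shift[OF assms(3)]]) simp
qed

lemma definable_mem:
  assumes "definable_term E t" "definable_term E u"
  shows "definable E (\<lambda>s. E (t s) (u s))"
proof (rule definable_subst2[where P=E, OF _ assms])
  show "definable E (\<lambda>s. E (s 0) (s 1))"
    by (rule definableI[where \<phi>="Mem 0 1" and \<rho>="\<lambda>n. 2 * n"]) (simp add: weave_def)
qed

lemma definable_eq:
  assumes "definable_term E t" "definable_term E u"
  shows "definable E (\<lambda>s. t s = u s)"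
proof (rule definable_subst2[where P="(=)", OF _ assms])
  show "definable E (\<lambda>s. s 0 = s 1)"
    by (rule definableI[where \<phi>="Eq 0 1" and \<rho>="\<lambda>n. 2 * n"]) (simp add: weave_def)
qed

named_theorems dfb

lemmas [dfb] = definable_not definable_conj definable_disj definable_imp definable_iff
  definable_ex definable_all definable_mem definable_eq definable_term_var definable_term_const

lemma definable_term_if [dfb]:
  assumes "definable E c" "definable_term E t" "definable_term E u"
  shows "definable_term E (\<lambda>s. if c s then t s else u s)"
proof -
  have "(\<lambda>s. s 0 = (if c (\<lambda>i. s (Suc i)) then t (\<lambda>i. s (Suc i)) else u (\<lambda>i. s (Suc i)))) =
      (\<lambda>s. (c (\<lambda>i. s (Suc i)) \<longrightarrow> s 0 = t (\<lambda>i. s (Suc i))) \<and>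
        (\<not> c (\<lambda>i. s (Suc i)) \<longrightarrow> s 0 = u (\<lambda>i. s (Suc i))))"
    by auto
  then show ?thesis
    using assms(2,3) definable_rename[OF assms(1), of Suc] unfolding definable_term_def
    by (simp only:) (intro definable_conj definable_imp definable_not)
qed

lemma definable_term_comp1:
  assumes "definable E (\<lambda>s. s 0 = G (s 1))" "definable_term E t"
  shows "definable_term E (\<lambda>s. G (t s))"
  unfolding definable_term_def
  by (rule definable_subst2[OF assms(1) definable_term_var definable_term_shift[OF assms(2)]])

lemma definable_term_comp2:
  assumes "definable E (\<lambda>s. s 0 = G (s 1) (s 2))" "definable_term E t" "definable_term E u"
  shows "definable_term E (\<lambda>s. G (t s) (u s))"
  unfolding definable_term_def
  by (rule definable_subst3[OF assms(1) definable_term_var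
        definable_term_shift[OF assms(2)] definable_term_shift[OF assms(3)]])

lemma definable_is_upair [dfb]:
  assumes "definable_term E t" "definable_term E u" "definable_term E v"
  shows "definable E (\<lambda>s. is_upair E (t s) (u s) (v s))"
  by (rule definable_subst3[where P="is_upair E", OF _ assms]) (unfold is_upair_def, intro dfb)

lemma definable_is_pair [dfb]:
  assumes "definable_term E t" "definable_term E u" "definable_term E v"
  shows "definable E (\<lambda>s. is_pair E (t s) (u s) (v s))"
  by (rule definable_subst3[where P="is_pair E", OF _ assms]) (unfold is_pair_def, intro dfb)

lemma definable_rel_of [dfb]:
  assumes "definable_term E t" "definable_term E u" "definable_term E v"
  shows "definable E (\<lambda>s. rel_of E (t s) (u s) (v s))"
  by (rule definable_subst3[where P="rel_of E", OF _ assms]) (unfold rel_of_def, intro dfb)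

lemma definable_is_empty [dfb]: "definable_term E t \<Longrightarrow> definable E (\<lambda>s. is_empty E (t s))"
  by (rule definable_let[where P="\<lambda>x s. is_empty E x"]) (assumption, unfold is_empty_def, intro dfb)

lemma definable_is_succ [dfb]:
  assumes "definable_term E t" "definable_term E u"
  shows "definable E (\<lambda>s. is_succ E (t s) (u s))"
  by (rule definable_subst2[where P="is_succ E", OF _ assms]) (unfold is_succ_def, intro dfb)

lemma definable_is_inductive [dfb]: "definable_term E t \<Longrightarrow> definable E (\<lambda>s. is_inductive E (t s))"
  by (rule definable_let[where P="\<lambda>x s. is_inductive E x"])
    (assumption, unfold is_inductive_def, intro dfb)

section \<open>Arithmetic of the natural numbers of the model\<close>

locale zfc_minus_model =
  fixes E :: "'a \<Rightarrow> 'a \<Rightarrow> bool"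
  assumes zfc_minus: "ZFC_minus E"
begin

lemmas axs = zfc_minus[unfolded ZFC_minus_def]

section \<open>Consequences of the axioms\<close>

lemma ext: "(\<And>z. E z x \<longleftrightarrow> E z y) \<Longrightarrow> x = y"
  by (rule axs[THEN conjunct1, rule_format]) blast

lemma foundation: "E y x \<Longrightarrow> \<exists>y. E y x \<and> \<not> (\<exists>z. E z y \<and> E z x)"
  by (rule axs[THEN conjunct2, THEN conjunct1, rule_format]) blast

lemma pairing: "\<exists>z. E x z \<and> E y z"
  by (rule axs[THEN conjunct2, THEN conjunct2, THEN conjunct1, rule_format])

lemma union: "\<exists>u. \<forall>z. (\<exists>y. E y x \<and> E z y) \<longrightarrow> E z u"
  by (rule axs[THEN conjunct2, THEN conjunct2, THEN conjunct2, THEN conjunct1, THEN spec])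

lemma infinity: "\<exists>a. is_inductive E a"
  by (rule axs[THEN conjunct2, THEN conjunct2, THEN conjunct2, THEN conjunct2, THEN conjunct1])

lemma separation:
  assumes "definable E (\<lambda>s. P (s 0))"
  shows "\<exists>b. \<forall>z. E z b \<longleftrightarrow> E z a \<and> P z"
proof -
  obtain \<phi> c where 1: "\<And>s. P (s 0) \<longleftrightarrow> sat E (weave s c) \<phi>"
    using assms unfolding definable_def by blast
  \<comment> \<open>Filling the even positions other than 0 with values of \<open>c\<close> is
    harmless, because the predicate depends on \<open>s 0\<close> alone.\<close>
  obtain b where b: "\<forall>z. E z b \<longleftrightarrow> (E z a \<and> sat E ((weave c c)(0 := z)) \<phi>)"
    using axs[THEN conjunct2, THEN conjunct2, THEN conjunct2, THEN conjunct2, THEN conjunct2,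
        THEN conjunct1] by blast
  have "(weave c c)(0 := z) = weave (c(0 := z)) c" for z
    by (auto simp: weave_def fun_eq_iff)
  moreover have "P z \<longleftrightarrow> sat E (weave (c(0 := z)) c) \<phi>" for z
    using 1[of "c(0 := z)"] by simp
  ultimately show ?thesis using b by auto
qed

lemma upair_ex: "\<exists>z. is_upair E z u v"
proof -
  obtain a where a: "E u a" "E v a" using pairing by blast
  have "definable E (\<lambda>s. s 0 = u \<or> s 0 = v)" by (intro dfb)
  from separation[of "\<lambda>z. z = u \<or> z = v", OF this, of a]
  obtain b where "\<forall>z. E z b \<longleftrightarrow> E z a \<and> (z = u \<or> z = v)" by blast
  then show ?thesis
    using a unfolding is_upair_def by metis
qed

lemma adjoin_ex: "\<exists>z. \<forall>w. E w z \<longleftrightarrow> E w x \<or> w = y"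
proof -
  obtain y' where y': "E y y'" using upair_ex[of y y] unfolding is_upair_def by blast
  then obtain p where p: "E x p" "E y' p" using pairing by blast
  obtain u where u: "\<And>z. (\<exists>y. E y p \<and> E z y) \<Longrightarrow> E z u"
    using union by blast
  have "definable E (\<lambda>s. E (s 0) x \<or> s 0 = y)" by (intro dfb)
  from separation[of "\<lambda>z. E z x \<or> z = y", OF this, of u]
  obtain b where b: "\<forall>z. E z b \<longleftrightarrow> E z u \<and> (E z x \<or> z = y)" by blast
  moreover have "E z u" if "E z x \<or> z = y" for z using u p y' that by blast
  ultimately show ?thesis by metis
qed

lemma upair_unique: "is_upair E z u v \<Longrightarrow> is_upair E z' u v \<Longrightarrow> z = z'"
  unfolding is_upair_def by (blast intro: ext)

lemma pair_ex: "\<exists>p. is_pair E p u v"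
proof -
  obtain a b where "is_upair E a u u" "is_upair E b u v" using upair_ex by blast
  moreover obtain p where "is_upair E p a b" using upair_ex by blast
  ultimately show ?thesis unfolding is_pair_def
    by (metis is_upair_def upair_unique)
qed

lemma pair_inj:
  assumes "is_pair E p u v" "is_pair E p u' v'"
  shows "u = u' \<and> v = v'"
proof -
  obtain a b where ab: "is_upair E a u u" "is_upair E b u v" using upair_ex by blast
  obtain a' b' where ab': "is_upair E a' u' u'" "is_upair E b' u' v'" using upair_ex by blast
  have "is_upair E a u' u' \<or> is_upair E a u' v'" "is_upair E b u' u' \<or> is_upair E b u' v'"
    "is_upair E a' u u \<or> is_upair E a' u v" "is_upair E b' u u \<or> is_upair E b' u v"
    using ab ab' assms unfolding is_pair_def by blast+
  with ab ab' show ?thesis unfolding is_upair_def by metis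
qed

lemma rel_adjoin_ex: "\<exists>g. \<forall>x y. rel_of E g x y \<longleftrightarrow> rel_of E f x y \<or> x = i \<and> y = v"
proof -
  obtain p where p: "is_pair E p i v" using pair_ex by blast
  obtain g where "\<forall>w. E w g \<longleftrightarrow> E w f \<or> w = p" using adjoin_ex by blast
  then show ?thesis unfolding rel_of_def using p pair_inj by metis
qed

section \<open>Zero, successor and omega as a set of the model\<close>

definition zero :: 'a where "zero = (THE e. is_empty E e)"

definition sc :: "'a \<Rightarrow> 'a" where "sc x = (THE y. is_succ E y x)"

lemma is_empty_iff: "is_empty E e \<longleftrightarrow> e = zero"
proof -
  obtain e where "is_empty E e" using infinity unfolding is_inductive_def by blast
  moreover have "x = y" if "is_empty E x" "is_empty E y" for x y
    using that ext unfolding is_empty_def by blast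
  ultimately show ?thesis unfolding zero_def by (metis the_equality)
qed

lemma not_in_zero [simp]: "\<not> E z zero"
  using is_empty_iff unfolding is_empty_def by blast

lemma is_succ_iff: "is_succ E y x \<longleftrightarrow> y = sc x"
proof -
  obtain y where "is_succ E y x" using adjoin_ex unfolding is_succ_def by blast
  moreover have "z = z'" if "is_succ E z x" "is_succ E z' x" for z z'
    using that ext unfolding is_succ_def by metis
  ultimately show ?thesis unfolding sc_def by (metis the_equality)
qed

lemma in_sc [simp]: "E z (sc x) \<longleftrightarrow> E z x \<or> z = x"
  using is_succ_iff unfolding is_succ_def by blast

lemma definable_term_sc [dfb]: "definable_term E t \<Longrightarrow> definable_term E (\<lambda>s. sc (t s))"
  by (rule definable_term_comp1[of E sc], unfold is_succ_iff[symmetric], intro dfb)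

lemma is_inductive_iff: "is_inductive E a \<longleftrightarrow> E zero a \<and> (\<forall>x. E x a \<longrightarrow> E (sc x) a)"
  unfolding is_inductive_def is_succ_iff is_empty_iff by blast

definition W :: 'a where "W = (SOME w. \<forall>z. E z w \<longleftrightarrow> z \<in> omega_hat E)"

lemma in_W: "E z W \<longleftrightarrow> z \<in> omega_hat E"
proof -
  obtain a where a: "is_inductive E a" using infinity by blast
  have "definable E (\<lambda>s. \<forall>b. is_inductive E b \<longrightarrow> E (s 0) b)" by (intro dfb)
  from separation[of "\<lambda>z. \<forall>b. is_inductive E b \<longrightarrow> E z b", OF this, of a]
  have "\<exists>w. \<forall>z. E z w \<longleftrightarrow> z \<in> omega_hat E" using a unfolding omega_hat_def by blast
  then show ?thesis unfolding W_def by (rule someI2_ex) blast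
qed

lemma zero_W [simp]: "E zero W"
  unfolding in_W omega_hat_def is_inductive_iff by blast

lemma sc_W [simp]: "E n W \<Longrightarrow> E (sc n) W"
  unfolding in_W omega_hat_def is_inductive_iff by blast

lemma W_induct [consumes 1, case_names definable zero sc]:
  assumes "E n W" "definable E (\<lambda>s. P (s 0))" "P zero" "\<And>m. E m W \<Longrightarrow> P m \<Longrightarrow> P (sc m)"
  shows "P n"
proof -
  obtain b where b: "\<forall>z. E z b \<longleftrightarrow> E z W \<and> P z" using separation[OF assms(2)] by blast
  then have "is_inductive E b" unfolding is_inductive_iff using assms(3,4) by simp
  then show ?thesis using assms(1) b unfolding in_W omega_hat_def by blast
qed

section \<open>The order of the natural numbers of the model\<close>

lemma W_trans:
  assumes "E n W" "E m n"
  shows "E m W"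
proof -
  have "E m n \<longrightarrow> E m W"
    using assms(1)
  proof (induction n rule: W_induct)
    case definable
    show ?case by (intro dfb)
  qed auto
  then show ?thesis using assms by blast
qed

lemma lt_trans:
  assumes "E n W" "E x y" "E y n"
  shows "E x n"
proof -
  have "\<forall>x y. E x y \<and> E y n \<longrightarrow> E x n"
    using assms(1)
  proof (induction n rule: W_induct)
    case definable
    show ?case by (intro dfb)
  qed auto
  then show ?thesis using assms by blast
qed

lemma irrefl [simp]: "\<not> E x x"
proof -
  obtain z where "is_upair E z x x" using upair_ex by blast
  then show ?thesis using foundation[of x z] unfolding is_upair_def by metis
qed

lemma asym:
  assumes "E x y"
  shows "\<not> E y x"
proof -
  obtain z where "is_upair E z x y" using upair_ex by blast
  then show ?thesis using assms foundation[of x z] unfolding is_upair_def by metis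
qed

definition le :: "'a \<Rightarrow> 'a \<Rightarrow> bool" where "le x y \<longleftrightarrow> E x y \<or> x = y"

lemma definable_le [dfb]:
  assumes "definable_term E t" "definable_term E u"
  shows "definable E (\<lambda>s. le (t s) (u s))"
  unfolding le_def using assms by (intro dfb)

lemma le_refl [simp]: "le x x" by (simp add: le_def)

lemma lt_sc_iff: "E x (sc y) \<longleftrightarrow> le x y" by (simp add: le_def)

lemma le_not_gt: "le x y \<Longrightarrow> \<not> E y x"
  using asym irrefl unfolding le_def by metis

lemma zero_le: "E n W \<Longrightarrow> le zero n"
proof (induction n rule: W_induct)
  case definable
  show ?case by (intro dfb)
qed (auto simp: le_def)

lemma sc_le:
  assumes "E n W" "E m n"
  shows "le (sc m) n"
proof -
  have "E m n \<longrightarrow> le (sc m) n"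
    using assms(1)
  proof (induction n rule: W_induct)
    case definable
    show ?case by (intro dfb)
  qed (auto simp: le_def)
  then show ?thesis using assms by blast
qed

lemma linear:
  assumes "E m W" "E n W"
  shows "E m n \<or> m = n \<or> E n m"
proof -
  have "\<forall>m. E m W \<longrightarrow> E m n \<or> m = n \<or> E n m"
    using assms(2)
  proof (induction n rule: W_induct)
    case definable
    show ?case by (intro dfb)
  next
    case zero
    then show ?case using zero_le le_def by blast
  next
    case (sc n)
    then show ?case using sc_le[of _ n] unfolding le_def by auto
  qed
  then show ?thesis using assms by blast
qed

lemma not_lt: "E m W \<Longrightarrow> E n W \<Longrightarrow> \<not> E m n \<longleftrightarrow> le n m"
  using linear[of m n] asym[of m n] unfolding le_def by auto

lemma not_le: "E m W \<Longrightarrow> E n W \<Longrightarrow> \<not> le m n \<longleftrightarrow> E n m"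
  using linear[of m n] asym[of m n] unfolding le_def by auto

lemma le_trans: "E z W \<Longrightarrow> le x y \<Longrightarrow> le y z \<Longrightarrow> le x z"
  using lt_trans unfolding le_def by blast

lemma le_lt_trans: "E z W \<Longrightarrow> le x y \<Longrightarrow> E y z \<Longrightarrow> E x z"
  using lt_trans unfolding le_def by blast

lemma lt_le_trans: "E z W \<Longrightarrow> E x y \<Longrightarrow> le y z \<Longrightarrow> E x z"
  using lt_trans unfolding le_def by blast

lemma le_antisym: "le x y \<Longrightarrow> le y x \<Longrightarrow> x = y"
  using asym unfolding le_def by blast

lemma sc_inj: "sc x = sc y \<Longrightarrow> x = y"
  by (metis asym in_sc)

lemma sc_neq_zero [simp]: "sc x \<noteq> zero"
  by (metis in_sc not_in_zero)

lemma W_cases: "E n W \<Longrightarrow> n = zero \<or> (\<exists>m. E m W \<and> n = sc m)"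
proof (induction n rule: W_induct)
  case definable
  show ?case by (intro dfb)
qed auto

text \<open>Foundation gives an \<open>E\<close>-minimal element of the set cut out by
  \<open>P\<close>, and minimal means least because the order is linear.\<close>

lemma least_ex:
  assumes "definable E (\<lambda>s. P (s 0))" "E n W" "P n"
  shows "\<exists>m. E m W \<and> P m \<and> (\<forall>k. E k W \<longrightarrow> P k \<longrightarrow> le m k)"
proof -
  obtain b where b: "\<forall>z. E z b \<longleftrightarrow> E z W \<and> P z" using separation[OF assms(1)] by blast
  then obtain m where "E m b" "\<not> (\<exists>z. E z m \<and> E z b)" using assms foundation[of n b] by blast
  then show ?thesis using b not_lt by (intro exI[of _ m]) blast
qed

text \<open>The maximum is the least upper bound: were it not attained, it would be a successor
  whose predecessor is a smaller upper bound.\<close>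

lemma greatest_ex:
  assumes "definable E (\<lambda>s. P (s 0))" "E n W" "P n" and B: "E B W" "\<And>k. E k W \<Longrightarrow> P k \<Longrightarrow> le k B"
  shows "\<exists>m. E m W \<and> P m \<and> (\<forall>k. E k W \<longrightarrow> P k \<longrightarrow> le k m)"
proof -
  let ?U = "\<lambda>u. \<forall>k. E k W \<longrightarrow> P k \<longrightarrow> le k u"
  have "definable E (\<lambda>s. P (s 1))" using definable_rename[OF assms(1), of Suc] by simp
  then have "definable E (\<lambda>s. \<forall>k. E k W \<longrightarrow> P k \<longrightarrow> le k (s 0))"
    using assms(1) by (intro dfb)
  from least_ex[of ?U, OF this B(1)] B(2)
  have "\<exists>u. E u W \<and> ?U u \<and> (\<forall>v. E v W \<longrightarrow> ?U v \<longrightarrow> le u v)" by blast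
  then obtain u where u: "E u W" "?U u" "\<And>v. E v W \<Longrightarrow> ?U v \<Longrightarrow> le u v" by blast
  have "P u"
  proof (rule ccontr)
    assume "\<not> P u"
    then have lt: "E k u" if "E k W" "P k" for k using u(2) that unfolding le_def by blast
    then have "u \<noteq> zero" using assms(2,3) by auto
    then obtain v where v: "E v W" "u = sc v" using W_cases u(1) by blast
    have "?U v" using lt v(2) lt_sc_iff by simp
    then have "le u v" using u(3) v(1) by blast
    then have "E u u" using lt_sc_iff[of u v] unfolding v(2)[symmetric] by blast
    then show False by simp
  qed
  then show ?thesis using u by blast
qed

section \<open>Recursion over the natural numbers of the model\<close>

text \<open>The approximations \<open>f\<close> below are not required to be functions: it suffices that each pair in
  \<open>f\<close> except \<open>(zero, p)\<close> has a predecessor in \<open>f\<close>, and then uniqueness of the value follows by induction.\<close>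

lemma recursion:
  assumes G: "definable E (\<lambda>s. s 0 = G (s 1) (s 2))"
  shows "\<exists>F. definable E (\<lambda>s. s 0 = F (s 1) (s 2)) \<and> (\<forall>p. F p zero = p) \<and>
    (\<forall>p j. E j W \<longrightarrow> F p (sc j) = G j (F p j))"
proof -
  define C where "C f p \<longleftrightarrow> (\<forall>i v. rel_of E f i v \<longrightarrow> i = zero \<and> v = p \<or>
    (\<exists>j w. E j W \<and> i = sc j \<and> rel_of E f j w \<and> v = G j w))" for f p
  define R where "R p n y \<longleftrightarrow> (\<exists>f. rel_of E f n y \<and> C f p)" for p n y
  note Gt = definable_term_comp2[OF G]
  have R_def': "definable E (\<lambda>s. R (s 2) (s 1) (s 0))"
    unfolding R_def C_def by (intro dfb Gt)
  note Rt = definable_subst3[where P="\<lambda>y n p. R p n y", OF R_def']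
  have R0: "R p zero y \<longleftrightarrow> y = p" for p y
  proof
    assume "R p zero y"
    then obtain f where "rel_of E f zero y" "C f p" unfolding R_def by blast
    then show "y = p" unfolding C_def using sc_neq_zero by metis
  next
    assume "y = p"
    moreover obtain f where "\<forall>x y. rel_of E f x y \<longleftrightarrow> rel_of E zero x y \<or> x = zero \<and> y = p"
      using rel_adjoin_ex by blast
    moreover have "\<not> rel_of E zero x y" for x y unfolding rel_of_def by simp
    ultimately have "rel_of E f zero y" "C f p" unfolding C_def by blast+
    then show "R p zero y" unfolding R_def by blast
  qed
  have Rsc: "R p (sc j) y \<longleftrightarrow> (\<exists>w. R p j w \<and> y = G j w)" if "E j W" for p j y
  proof
    assume "R p (sc j) y"
    then obtain f where f: "rel_of E f (sc j) y" "C f p" unfolding R_def by blast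
    then obtain j' w where "sc j = sc j'" "rel_of E f j' w" "y = G j' w"
      unfolding C_def using sc_neq_zero by metis
    then show "\<exists>w. R p j w \<and> y = G j w" using f(2) sc_inj unfolding R_def by blast
  next
    assume "\<exists>w. R p j w \<and> y = G j w"
    then obtain w f where f: "rel_of E f j w" "C f p" "y = G j w" unfolding R_def by blast
    obtain g where g: "\<forall>u v. rel_of E g u v \<longleftrightarrow> rel_of E f u v \<or> u = sc j \<and> v = y"
      using rel_adjoin_ex by blast
    have "C g p"
      unfolding C_def
    proof (intro allI impI)
      fix i v
      assume "rel_of E g i v"
      then consider "rel_of E f i v" | "i = sc j" "v = y" using g by blast
      then show "i = zero \<and> v = p \<or> (\<exists>j w. E j W \<and> i = sc j \<and> rel_of E g j w \<and> v = G j w)"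
      proof cases
        case 1
        then show ?thesis using f(2) g unfolding C_def by blast
      next
        case 2
        then show ?thesis using f(1,3) g that by blast
      qed
    qed
    then show "R p (sc j) y" using g unfolding R_def by blast
  qed
  have R_ex1: "\<exists>y. R p n y \<and> (\<forall>z. R p n z \<longrightarrow> z = y)" if "E n W" for p n
    using that
  proof (induction n rule: W_induct)
    case definable
    show ?case by (intro dfb Rt)
  next
    case zero
    show ?case using R0 by blast
  next
    case (sc m)
    then show ?case using Rsc[OF sc(1)] by blast
  qed
  \<comment> \<open>Outside \<open>W\<close> the value is fixed to be \<open>zero\<close>, which
    makes the graph of \<open>F\<close> definable for all arguments.\<close>
  define F where "F p n = (if E n W then THE y. R p n y else zero)" for p n
  have F: "y = F p n \<longleftrightarrow> R p n y" if n: "E n W" for p n y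
  proof -
    obtain z where z: "R p n z" "\<And>z'. R p n z' \<Longrightarrow> z' = z" using R_ex1[OF n] by blast
    have "(THE y. R p n y) = z" by (rule the_equality) (fact z)+
    then have "F p n = z" unfolding F_def using n by simp
    then show ?thesis using z by blast
  qed
  have "(\<lambda>s :: nat \<Rightarrow> 'a. s 0 = F (s 1) (s 2)) =
      (\<lambda>s. E (s 2) W \<and> R (s 1) (s 2) (s 0) \<or> \<not> E (s 2) W \<and> s 0 = zero)"
    using F by (auto simp: fun_eq_iff F_def)
  moreover have "definable E (\<lambda>s. E (s 2) W \<and> R (s 1) (s 2) (s 0) \<or> \<not> E (s 2) W \<and> s 0 = zero)"
    by (intro dfb Rt)
  moreover have "F p zero = p" for p using F[of zero p p] R0 by simp
  moreover have "F p (sc j) = G j (F p j)" if "E j W" for p j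
    using F[of "sc j" "G j (F p j)" p] F[of j "F p j" p] Rsc[OF that] that by auto
  ultimately show ?thesis by (intro exI[of _ F]) simp
qed

section \<open>Division with remainder\<close>

lemma mono_from_sc:
  assumes "definable E (\<lambda>s. s 0 = f (s 1))" "\<And>z. E z W \<Longrightarrow> E (f z) W"
    and "\<And>z. E z W \<Longrightarrow> le (f z) (f (sc z))" and "E z W" "le y z"
  shows "le (f y) (f z)"
proof -
  note [dfb] = definable_term_comp1[OF assms(1)]
  have "le y z \<longrightarrow> le (f y) (f z)"
    using assms(4)
  proof (induction z rule: W_induct)
    case definable
    show ?case by (intro dfb)
  next
    case zero
    then show ?case by (auto simp: le_def)
  next
    case (sc m)
    show ?case
    proof
      assume "le y (sc m)"
      then consider "y = sc m" | "le y m" by (auto simp: le_def)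
      then show "le (f y) (f (sc m))"
        by cases (use sc assms(2,3) le_trans sc_W in \<open>blast intro: le_refl\<close>)+
    qed
  qed
  then show ?thesis using assms(5) by blast
qed

text \<open>Here \<open>q\<close> and \<open>r\<close> are quotient and remainder on division by \<open>n\<close>, obtained by counting.\<close>

lemma div_mod_ex:
  assumes n: "E n W" "E zero n"
  shows "\<exists>q r. definable E (\<lambda>s. s 0 = q (s 1)) \<and> definable E (\<lambda>s. s 0 = r (s 1)) \<and>
    (\<forall>z. E z W \<longrightarrow> E (q z) W \<and> E (r z) n) \<and>
    (\<forall>y z. E z W \<longrightarrow> le y z \<longrightarrow> le (q y) (q z)) \<and>
    (\<forall>y x. E y W \<longrightarrow> E x n \<longrightarrow> (\<exists>z. E z W \<and> q z = y \<and> r z = x))"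
proof -
  \<comment> \<open>The remainder counts upwards and returns to \<open>zero\<close> whenever it
    would reach \<open>n\<close>.\<close>
  have "definable E (\<lambda>s. s 0 = (\<lambda>j v. if sc v = n then zero else sc v) (s 1) (s 2))"
    by (intro dfb)
  from recursion[OF this] obtain F where F: "definable E (\<lambda>s. s 0 = F (s 1) (s 2))"
    "\<And>p. F p zero = p" "\<And>p j. E j W \<Longrightarrow> F p (sc j) = (if sc (F p j) = n then zero else sc (F p j))"
    by blast
  define r where "r = F zero"
  have rt [dfb]: "definable_term E t \<Longrightarrow> definable_term E (\<lambda>s. r (t s))" for t
    unfolding r_def by (intro dfb definable_term_comp2[OF F(1)])
  have r: "r zero = zero" "\<And>j. E j W \<Longrightarrow> r (sc j) = (if sc (r j) = n then zero else sc (r j))"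
    unfolding r_def using F(2,3) by auto
  \<comment> \<open>The quotient goes up exactly when the remainder returns to
    \<open>zero\<close>.\<close>
  have "definable E (\<lambda>s. s 0 = (\<lambda>j v. if r (sc j) = zero then sc v else v) (s 1) (s 2))"
    by (intro dfb)
  from recursion[OF this] obtain F' where F': "definable E (\<lambda>s. s 0 = F' (s 1) (s 2))"
    "\<And>p. F' p zero = p" "\<And>p j. E j W \<Longrightarrow> F' p (sc j) = (if r (sc j) = zero then sc (F' p j) else F' p j)"
    by blast
  define q where "q = F' zero"
  have qt [dfb]: "definable_term E t \<Longrightarrow> definable_term E (\<lambda>s. q (t s))" for t
    unfolding q_def by (intro dfb definable_term_comp2[OF F'(1)])
  have q: "q zero = zero" "\<And>j. E j W \<Longrightarrow> q (sc j) = (if r (sc j) = zero then sc (q j) else q j)"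
    unfolding q_def using F'(2,3) by auto
  have dq: "definable E (\<lambda>s. s 0 = q (s 1))" and dr: "definable E (\<lambda>s. s 0 = r (s 1))"
    by (intro dfb)+
  have rn: "E (r z) n" if "E z W" for z
    using that
  proof (induction z rule: W_induct)
    case definable
    show ?case by (intro dfb)
  next
    case zero
    then show ?case using r n by simp
  next
    case (sc m)
    then show ?case using r(2) n sc_le[of n "r m"] unfolding le_def by auto
  qed
  have qW: "E (q z) W" if "E z W" for z
    using that
  proof (induction z rule: W_induct)
    case definable
    show ?case by (intro dfb)
  qed (use q in auto)
  have mono: "le (q y) (q z)" if "E z W" "le y z" for y z
    by (rule mono_from_sc[OF dq qW _ that]) (use q(2) in \<open>auto simp: le_def\<close>)
  \<comment> \<open>From the start of a block with quotient \<open>y\<close>, counting up meets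
    every remainder below \<open>n\<close> before the quotient changes.\<close>
  have row: "\<exists>z. E z W \<and> q z = y \<and> r z = x" if "E z W" "q z = y" "r z = zero" "E x n" for x y z
  proof -
    have "E x W" using W_trans n that by blast
    then have "E x n \<longrightarrow> (\<exists>z. E z W \<and> q z = y \<and> r z = x)"
    proof (induction x rule: W_induct)
      case definable
      show ?case by (intro dfb)
    next
      case zero
      then show ?case using that by blast
    next
      case (sc x)
      show ?case
      proof
        assume x: "E (sc x) n"
        then have "E x n" using lt_trans[OF n(1) _ x, of x] by simp
        then obtain z where z: "E z W" "q z = y" "r z = x" using sc by blast
        have "sc x \<noteq> n" using x by auto
        then have "r (sc z) = sc x" using r(2)[OF z(1)] z(3) by simp
        moreover have "q (sc z) = y" using q(2)[OF z(1)] z(2) \<open>r (sc z) = sc x\<close> by simp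
        ultimately show "\<exists>z. E z W \<and> q z = y \<and> r z = sc x" using z(1) sc_W by blast
      qed
    qed
    then show ?thesis using that by blast
  qed
  have start: "\<exists>z. E z W \<and> q z = y \<and> r z = zero" if "E y W" for y
    using that
  proof (induction y rule: W_induct)
    case definable
    show ?case by (intro dfb)
  next
    case zero
    then show ?case using q(1) r(1) zero_W by blast
  next
    case (sc y)
    \<comment> \<open>The block ends at remainder \<open>m\<close>, the predecessor of
      \<open>n\<close>; one step further the next block starts.\<close>
    obtain m where m: "n = sc m" using W_cases[OF n(1)] n(2) by auto
    then have "E m n" by simp
    then obtain z where z: "E z W" "q z = y" "r z = m" using row sc(2) by blast
    then have "r (sc z) = zero" using r(2) m by simp
    then show ?case using q(2)[OF z(1)] z by (intro exI[of _ "sc z"]) simp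
  qed
  have "\<exists>z. E z W \<and> q z = y \<and> r z = x" if "E y W" "E x n" for x y
    using start[OF that(1)] row that(2) by blast
  then show ?thesis using dq dr rn qW mono by blast
qed

end

section \<open>The tree of digit expansions\<close>

text \<open>\<open>Q z k\<close> is the node at height \<open>k\<close> of the branch coded by \<open>z\<close>, and \<open>d z k\<close> is the digit
  on the edge leading down to it: in base \<open>n\<close>, \<open>Q z k\<close> drops the last \<open>k\<close>
  digits of \<open>z\<close> and \<open>d z k\<close> is the last digit that remains.\<close>

locale digit_tree = zfc_minus_model +
  fixes n :: 'a and Q d :: "'a \<Rightarrow> 'a \<Rightarrow> 'a"
  assumes definable_Q: "definable E (\<lambda>s. s 0 = Q (s 1) (s 2))"
    and definable_d: "definable E (\<lambda>s. s 0 = d (s 1) (s 2))"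
    and d_less: "\<And>z k. E z W \<Longrightarrow> E k W \<Longrightarrow> E (d z k) n"
    and Q_agree: "\<And>z z' k k'. E k' W \<Longrightarrow> le k k' \<Longrightarrow> Q z k = Q z' k \<Longrightarrow>
      Q z k' = Q z' k' \<and> d z k' = d z' k'"
    and Q_mono: "\<And>z z' k. E z' W \<Longrightarrow> E k W \<Longrightarrow> le z z' \<Longrightarrow> le (Q z k) (Q z' k)"
    and Q_bounded: "\<And>z k. E z W \<Longrightarrow> E k W \<Longrightarrow> \<exists>b. E b W \<and> (\<forall>z'. E z' W \<longrightarrow> Q z' k = Q z k \<longrightarrow> le z' b)"
    and Q_extend: "\<And>z k x. E z W \<Longrightarrow> E k W \<Longrightarrow> E x n \<Longrightarrow>
      \<exists>z'. E z' W \<and> Q z' (sc k) = Q z (sc k) \<and> d z' k = x"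

text \<open>\<open>Q z k\<close> applies the quotient map \<open>k\<close> times to
  \<open>z\<close>, and the digit is the remainder of that node. Monotonicity and surjectivity of
  division give the tree laws by induction on the height.\<close>

lemma (in zfc_minus_model) digit_tree_ex:
  assumes n: "E n W" "E zero n"
  shows "\<exists>Q d. digit_tree E n Q d"
proof -
  obtain q r where dq: "definable E (\<lambda>s. s 0 = q (s 1))" and dr: "definable E (\<lambda>s. s 0 = r (s 1))"
    and qW: "\<And>z. E z W \<Longrightarrow> E (q z) W" and rn: "\<And>z. E z W \<Longrightarrow> E (r z) n"
    and q_mono: "\<And>y z. E z W \<Longrightarrow> le y z \<Longrightarrow> le (q y) (q z)"
    and surj: "\<And>y x. E y W \<Longrightarrow> E x n \<Longrightarrow> \<exists>z. E z W \<and> q z = y \<and> r z = x"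
    using div_mod_ex[OF n] by blast
  note [dfb] = definable_term_comp1[OF dq] definable_term_comp1[OF dr]
  have "definable E (\<lambda>s. s 0 = (\<lambda>j v. q v) (s 1) (s 2))" by (intro dfb)
  from recursion[OF this] obtain Q where dQ: "definable E (\<lambda>s. s 0 = Q (s 1) (s 2))"
    and Q: "\<And>p. Q p zero = p" "\<And>p j. E j W \<Longrightarrow> Q p (sc j) = q (Q p j)" by blast
  note [dfb] = definable_term_comp2[OF dQ]
  have QW: "E (Q z k) W" if "E z W" "E k W" for z k
    using that(2)
  proof (induction k rule: W_induct)
    case definable
    show ?case by (intro dfb)
  qed (use Q qW that in auto)
  have mono: "le (Q z k) (Q z' k)" if "E z' W" "E k W" "le z z'" for z z' k
    using that(2)
  proof (induction k rule: W_induct)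
    case definable
    show ?case by (intro dfb)
  qed (use Q q_mono QW that in auto)
  have agree: "Q z k' = Q z' k'" if "E k' W" "le k k'" "Q z k = Q z' k" for z z' k k'
  proof -
    have "le k k' \<longrightarrow> Q z k' = Q z' k'"
      using that(1)
    proof (induction k' rule: W_induct)
      case definable
      show ?case by (intro dfb)
    next
      case zero
      then show ?case using that by (auto simp: le_def)
    next
      case (sc m)
      then show ?case using that(3) Q(2) by (auto simp: le_def)
    qed
    then show ?thesis using that by blast
  qed
  have onto: "\<exists>z. E z W \<and> Q z k = w" if "E k W" "E w W" for k w
  proof -
    have "\<forall>w. E w W \<longrightarrow> (\<exists>z. E z W \<and> Q z k = w)"
      using that(1)
    proof (induction k rule: W_induct)
      case definable
      show ?case by (intro dfb)
    next
      case zero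
      then show ?case using Q(1) by blast
    next
      case (sc k)
      show ?case
      proof (intro allI impI)
        fix w
        assume "E w W"
        then obtain v where "E v W" "q v = w" using surj n(2) by blast
        then show "\<exists>z. E z W \<and> Q z (sc k) = w" using sc Q(2)[OF sc(1)] by auto
      qed
    qed
    then show ?thesis using that by blast
  qed
  have bounded: "\<exists>b. E b W \<and> (\<forall>z'. E z' W \<longrightarrow> Q z' k = Q z k \<longrightarrow> le z' b)"
    if z: "E z W" and k: "E k W" for z k
  proof -
    \<comment> \<open>The bound is a number above the next node at height \<open>k\<close>: by
      monotonicity no number through \<open>Q z k\<close> can exceed it.\<close>
    obtain b where b: "E b W" "Q b k = sc (Q z k)"
      using onto[OF k sc_W[OF QW[OF z k]]] by blast
    have "le z' b" if z': "E z' W" "Q z' k = Q z k" for z'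
    proof (rule ccontr)
      assume "\<not> le z' b"
      then have "le b z'" using not_le b(1) z'(1) le_def by blast
      then have "le (sc (Q z k)) (Q z k)" using mono[OF z'(1) \<open>E k W\<close>, of b] b z' by simp
      then have "E (Q z k) (Q z k)"
        using lt_le_trans[of "Q z k" "Q z k" "sc (Q z k)"] QW \<open>E z W\<close> \<open>E k W\<close> by simp
      then show False by simp
    qed
    then show ?thesis using b(1) by blast
  qed
  have extend: "\<exists>z'. E z' W \<and> Q z' (sc k) = Q z (sc k) \<and> r (Q z' k) = x"
    if z: "E z W" and k: "E k W" and x: "E x n" for z k x
  proof -
    \<comment> \<open>\<open>v\<close> is the child of the node \<open>Q z (sc k)\<close> along the
      edge \<open>x\<close>; any number through \<open>v\<close> is the required branch.\<close>
    obtain v where v: "E v W" "q v = Q z (sc k)" "r v = x"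
      using surj[OF QW[OF z sc_W[OF k]] x] by blast
    obtain z' where "E z' W" "Q z' k = v" using onto[OF k v(1)] by blast
    then show ?thesis using v Q(2)[OF k] by (intro exI[of _ z']) simp
  qed
  have "digit_tree E n Q (\<lambda>z k. r (Q z k))"
  proof unfold_locales
    show "definable E (\<lambda>s. s 0 = r (Q (s 1) (s 2)))" by (intro dfb)
    show "Q z k' = Q z' k' \<and> r (Q z k') = r (Q z' k')" if "E k' W" "le k k'" "Q z k = Q z' k"
      for z z' k k' using agree[OF that] by simp
  qed (fact dQ rn[OF QW] mono bounded extend)+
  then show ?thesis by blast
qed

section \<open>Cofinal sequences and cuts\<close>

text \<open>The bound of the length \<open>r\<close> by the size of \<open>S\<close> is what makes
  the cuts built from such sequences small.\<close>

definition regular_cofinal_seq :: "'a set \<Rightarrow> ('a \<Rightarrow> 'a \<Rightarrow> bool) \<Rightarrow> 'k rel \<Rightarrow> ('k \<Rightarrow> 'a) \<Rightarrow> bool" where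
  "regular_cofinal_seq S lt r f \<longleftrightarrow>
    Card_order r \<and> Cinfinite r \<and> regularCard r \<and> r \<le>o |S| \<and> f ` Field r \<subseteq> S \<and>
    (\<forall>\<alpha>\<in>Field r. \<forall>\<beta>\<in>Field r. (\<alpha>, \<beta>) \<in> r \<and> \<alpha> \<noteq> \<beta> \<longrightarrow> lt (f \<alpha>) (f \<beta>)) \<and>
    (\<forall>x\<in>S. \<exists>\<alpha>\<in>Field r. lt x (f \<alpha>))"

text \<open>A cofinal set \<open>C\<close> of least cardinality is well-ordered in that cardinality,
  and the sequence climbs along it: \<open>f x\<close> lies above \<open>x\<close> and all earlier
  values. Minimality keeps the climb going and makes the length regular.\<close>

lemma regular_cofinal_seq_ex:
  fixes S :: "'a set" and lt :: "'a \<Rightarrow> 'a \<Rightarrow> bool"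
  assumes irr: "\<And>x. x \<in> S \<Longrightarrow> \<not> lt x x"
    and tr: "\<And>x y z. x \<in> S \<Longrightarrow> y \<in> S \<Longrightarrow> z \<in> S \<Longrightarrow> lt x y \<Longrightarrow> lt y z \<Longrightarrow> lt x z"
    and lin: "\<And>x y. x \<in> S \<Longrightarrow> y \<in> S \<Longrightarrow> lt x y \<or> x = y \<or> lt y x"
    and ne: "S \<noteq> {}" and no_max: "\<And>x. x \<in> S \<Longrightarrow> \<exists>y\<in>S. lt x y"
  shows "\<exists>(r :: 'a rel) f. regular_cofinal_seq S lt r f"
proof -
  define cof where "cof C \<longleftrightarrow> C \<subseteq> S \<and> (\<forall>x\<in>S. \<exists>y\<in>C. lt x y)" for C
  have "cof S" unfolding cof_def using no_max by blast
  have "\<exists>r \<in> card_of ` Collect cof. \<forall>r' \<in> card_of ` Collect cof. r \<le>o r'"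
    by (rule exists_minim_Card_order) (use \<open>cof S\<close> card_of_Card_order in auto)
  then obtain C where C: "cof C" and C_min: "\<And>C'. cof C' \<Longrightarrow> |C| \<le>o |C'|" by auto
  have CS: "C \<subseteq> S" and C_cof: "\<And>x. x \<in> S \<Longrightarrow> \<exists>y\<in>C. lt x y" using C unfolding cof_def by auto
  have fin_bound: "\<exists>u\<in>S. \<forall>x\<in>F. lt x u" if "finite F" "F \<subseteq> S" for F
    using that
  proof (induction F)
    case empty
    then show ?case using ne by blast
  next
    case (insert x F)
    then obtain u where u: "u \<in> S" "\<forall>x\<in>F. lt x u" by blast
    obtain v where v: "v \<in> S" "lt u v" using no_max u by blast
    obtain w where w: "w \<in> S" "lt x w" using no_max insert.prems by blast
    have "\<forall>x\<in>F. lt x v" using u v tr insert.prems by blast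
    moreover have "v = w \<or> lt v w \<or> lt w v" using lin v w by blast
    ultimately show ?case using v w tr insert.prems by (metis insert_iff subsetD)
  qed
  have "\<not> finite C" using fin_bound[OF _ CS] C_cof irr tr CS by (meson subsetD)
  let ?r = "|C|"
  have F: "Field ?r = C" by (rule Field_card_of)
  have wf: "wf (?r - Id)"
    using card_of_Well_order[of C] unfolding well_order_on_def by simp
  let ?P = "\<lambda>f x v. x \<in> C \<longrightarrow> v \<in> S \<and> lt x v \<and> (\<forall>y \<in> underS ?r x. lt (f y) v)"
  have "\<exists>f. \<forall>x. ?P f x (f x)"
  proof (rule dependent_wf_choice[OF wf])
    show "?P f x v = ?P g x v" if "\<And>z. (z, x) \<in> ?r - Id \<Longrightarrow> f z = g z" for f g x v
      using that unfolding underS_def by auto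
  next
    fix x f
    assume IH: "?P f y (f y)" if "(y, x) \<in> ?r - Id" for y
    show "\<exists>v. ?P f x v"
    proof (cases "x \<in> C")
      case True
      have sub: "f ` underS ?r x \<subseteq> S"
      proof
        fix w
        assume "w \<in> f ` underS ?r x"
        then obtain y where y: "w = f y" "(y, x) \<in> ?r - Id" unfolding underS_def by auto
        then have "y \<in> C" using F unfolding Field_def by auto
        then show "w \<in> S" using IH y by blast
      qed
      \<comment> \<open>There are fewer than \<open>|C|\<close> earlier values, so they are not
        cofinal, and some \<open>u\<close> is below none of them.\<close>
      have "|f ` underS ?r x| <o ?r"
        using card_of_underS[OF card_of_Card_order, of x C] True F card_of_image ordLeq_ordLess_trans
        by blast
      then have "\<not> cof (f ` underS ?r x)" using C_min not_ordLess_ordLeq by blast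
      then obtain u where u: "u \<in> S" "\<And>w. w \<in> f ` underS ?r x \<Longrightarrow> \<not> lt u w"
        unfolding cof_def using sub by blast
      obtain v where v: "v \<in> S" "lt u v" "lt x v"
        using fin_bound[of "{u, x}"] u True CS by auto
      have "lt w v" if "w \<in> f ` underS ?r x" for w
        using lin[OF _ u(1)] u(2) sub tr v u(1) that by blast
      then show ?thesis using v by blast
    qed simp
  qed
  then obtain f where f: "\<And>x. x \<in> C \<Longrightarrow> f x \<in> S" "\<And>x. x \<in> C \<Longrightarrow> lt x (f x)"
    "\<And>x y. x \<in> C \<Longrightarrow> y \<in> underS ?r x \<Longrightarrow> lt (f y) (f x)" by blast
  have "regularCard ?r"
    unfolding regularCard_def
  proof (intro allI impI)
    fix K
    assume K: "K \<subseteq> Field ?r \<and> cofinal K ?r"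
    \<comment> \<open>Given \<open>x\<close> in \<open>S\<close>, take \<open>c\<close> in
      \<open>C\<close> above \<open>x\<close> and \<open>b\<close> in \<open>K\<close> beyond
      \<open>c\<close> in the well-order: then \<open>x\<close>, \<open>c\<close>,
      \<open>f c\<close>, \<open>f b\<close> increase.\<close>
    have "cof (f ` K)"
      unfolding cof_def
    proof (intro conjI ballI)
      show "f ` K \<subseteq> S" using K F f by blast
    next
      fix x
      assume x: "x \<in> S"
      then obtain c where c: "c \<in> C" "lt x c" using C_cof by blast
      then obtain b where b: "b \<in> K" "c \<noteq> b" "(c, b) \<in> ?r"
        using K F unfolding cofinal_def by blast
      then have "c \<in> underS ?r b" "b \<in> C" using K F unfolding underS_def by auto
      then have "lt c (f c)" "lt (f c) (f b)" "f c \<in> S" "f b \<in> S" using f c by auto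
      then have "lt x (f b)" using tr x c CS by blast
      then show "\<exists>y\<in>f ` K. lt x y" using b by blast
    qed
    then have "|C| \<le>o |K|" using C_min card_of_image ordLeq_transitive by blast
    then show "|K| =o |C|" using K F card_of_mono1 ordIso_iff_ordLeq by metis
  qed
  moreover have "Cinfinite ?r" using \<open>\<not> finite C\<close> F by (simp add: cinfinite_def card_of_card_order_on)
  moreover have "lt (f \<alpha>) (f \<beta>)" if "\<alpha> \<in> C" "\<beta> \<in> C" "(\<alpha>, \<beta>) \<in> ?r" "\<alpha> \<noteq> \<beta>" for \<alpha> \<beta>
    using f(3)[OF that(2)] that unfolding underS_def by blast
  moreover have "\<exists>\<alpha>\<in>C. lt x (f \<alpha>)" if x: "x \<in> S" for x
  proof -
    obtain y where y: "y \<in> C" "lt x y" using C_cof[OF x] by blast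
    then have "lt x (f y)" using tr[of x y "f y"] f(1,2)[of y] x CS by blast
    then show ?thesis using y by blast
  qed
  ultimately have "regular_cofinal_seq S lt ?r f"
    unfolding regular_cofinal_seq_def F
    using card_of_Card_order[of C] card_of_mono1[OF CS] f(1) F by auto
  then show ?thesis by blast
qed

context zfc_minus_model
begin

text \<open>If nothing lies between \<open>S\<close> and \<open>U\<close>, then \<open>S\<close> has
  no maximum and \<open>U\<close> no minimum, since these would separate. Regular cofinal sequences
  in \<open>S\<close> and, for the reversed order, in \<open>U\<close> then form a cut with sum of
  lengths at most \<open>|I|\<close>, against \<open>below_p\<close>.\<close>

lemma no_small_cut:
  assumes bp: "below_p E I" and inf: "infinite I"
    and S: "\<And>x. x \<in> S \<Longrightarrow> E x W" "|S| \<le>o |I|"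
    and U: "\<And>x. x \<in> U \<Longrightarrow> E x W" "|U| \<le>o |I|" "U \<noteq> {}"
    and SU: "\<And>x y. x \<in> S \<Longrightarrow> y \<in> U \<Longrightarrow> le x y"
  shows "\<exists>c. E c W \<and> (\<forall>x\<in>S. le x c) \<and> (\<forall>y\<in>U. le c y)"
proof (rule ccontr)
  assume no: "\<not> ?thesis"
  have "S \<noteq> {}"
  proof
    assume "S = {}"
    then show False using no zero_W zero_le U by blast
  qed
  have S_max: "\<exists>y\<in>S. E x y" if "x \<in> S" for x
  proof (rule ccontr)
    assume "\<not> ?thesis"
    then have "\<forall>y\<in>S. le y x" using not_lt S that by blast
    then show False using no S that SU by blast
  qed
  have U_min: "\<exists>y\<in>U. E y x" if "x \<in> U" for x
  proof (rule ccontr)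
    assume "\<not> ?thesis"
    then have "\<forall>y\<in>U. le x y" using not_lt U that by blast
    then show False using no U that SU by blast
  qed
  have "\<exists>(r :: 'a rel) f. regular_cofinal_seq S E r f"
  proof (rule regular_cofinal_seq_ex)
    show "E x z" if "z \<in> S" "E x y" "E y z" for x y z using lt_trans[OF S(1)] that by blast
    show "E x y \<or> x = y \<or> E y x" if "x \<in> S" "y \<in> S" for x y using linear[OF S(1) S(1)] that by blast
  qed (use \<open>S \<noteq> {}\<close> S_max in auto)
  then obtain r f where rf: "regular_cofinal_seq S E (r :: 'a rel) f" by blast
  have "\<exists>(t :: 'a rel) g. regular_cofinal_seq U (\<lambda>x y. E y x) t g"
  proof (rule regular_cofinal_seq_ex)
    show "E z x" if "x \<in> U" "E y x" "E z y" for x y z using lt_trans[OF U(1)] that by blast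
    show "E y x \<or> x = y \<or> E x y" if "x \<in> U" "y \<in> U" for x y using linear[OF U(1) U(1)] that by blast
  qed (use U(3) U_min in auto)
  then obtain t g where tg: "regular_cofinal_seq U (\<lambda>x y. E y x) (t :: 'a rel) g" by blast
  have r: "Card_order r" "Cinfinite r" "regularCard r" "r \<le>o |S|" and fS: "f ` Field r \<subseteq> S"
    and f_mono: "\<forall>\<alpha>\<in>Field r. \<forall>\<beta>\<in>Field r. (\<alpha>, \<beta>) \<in> r \<and> \<alpha> \<noteq> \<beta> \<longrightarrow> E (f \<alpha>) (f \<beta>)"
    and f_cof: "\<And>x. x \<in> S \<Longrightarrow> \<exists>\<alpha>\<in>Field r. E x (f \<alpha>)"
    using rf unfolding regular_cofinal_seq_def by simp_all
  have t: "Card_order t" "Cinfinite t" "regularCard t" "t \<le>o |U|" and gU: "g ` Field t \<subseteq> U"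
    and g_mono: "\<forall>\<alpha>\<in>Field t. \<forall>\<beta>\<in>Field t. (\<alpha>, \<beta>) \<in> t \<and> \<alpha> \<noteq> \<beta> \<longrightarrow> E (g \<beta>) (g \<alpha>)"
    and g_cof: "\<And>x. x \<in> U \<Longrightarrow> \<exists>\<alpha>\<in>Field t. E (g \<alpha>) x"
    using tg unfolding regular_cofinal_seq_def by simp_all
  let ?lt = "\<lambda>x y. x \<in> omega_hat E \<and> y \<in> omega_hat E \<and> E x y"
  have fg: "E (f \<alpha>) (g \<beta>)" if "\<alpha> \<in> Field r" "\<beta> \<in> Field t" for \<alpha> \<beta>
  proof -
    have "f \<alpha> \<in> S" "g \<beta> \<in> U" using fS gU that by auto
    \<comment> \<open>Strictness comes from passing to a larger element of \<open>S\<close>, which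
      has no maximum.\<close>
    moreover obtain y where "y \<in> S" "E (f \<alpha>) y" using S_max \<open>f \<alpha> \<in> S\<close> by blast
    ultimately show ?thesis using SU lt_le_trans[OF U(1)] by blast
  qed
  have no_c: False if c: "E c W" "\<forall>\<alpha>\<in>Field r. \<forall>\<beta>\<in>Field t. E (f \<alpha>) c \<and> E c (g \<beta>)" for c
  proof -
    have ne: "Field r \<noteq> {}" "Field t \<noteq> {}" using r(2) t(2) unfolding cinfinite_def by auto
    have "le x c" if x: "x \<in> S" for x
    proof -
      obtain \<alpha> where "\<alpha> \<in> Field r" "E x (f \<alpha>)" using f_cof x by blast
      then show ?thesis using lt_trans[OF c(1)] c(2) ne unfolding le_def by blast
    qed
    moreover have "le c x" if x: "x \<in> U" for x
    proof -
      obtain \<beta> where "\<beta> \<in> Field t" "E (g \<beta>) x" using g_cof x by blast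
      then show ?thesis using lt_trans[OF U(1)[OF x]] c(2) ne unfolding le_def by blast
    qed
    ultimately show False using no c(1) by blast
  qed
  have W: "f ` Field r \<subseteq> omega_hat E" "g ` Field t \<subseteq> omega_hat E"
    using fS gU S(1) U(1) unfolding in_W by auto
  have "\<not> (\<exists>c\<in>omega_hat E. \<forall>\<alpha>\<in>Field r. \<forall>\<beta>\<in>Field t. ?lt (f \<alpha>) c \<and> ?lt c (g \<beta>))"
    using no_c unfolding in_W by blast
  moreover have "f \<alpha> \<in> omega_hat E" if "\<alpha> \<in> Field r" for \<alpha> using W that by blast
  moreover have "g \<beta> \<in> omega_hat E" if "\<beta> \<in> Field t" for \<beta> using W that by blast
  ultimately have "is_cut (omega_hat E) ?lt r t"
    using W f_mono g_mono fg unfolding is_cut_def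
    by (intro exI[of _ f] exI[of _ g]) simp
  then have "|I| <o r +c t" using bp r t unfolding below_p_def by blast
  moreover have "r +c t \<le>o |I|"
    using r t inf ordLeq_transitive[OF r(4) S(2)] ordLeq_transitive[OF t(4) U(2)]
    by (intro csum_cinfinite_bound) (auto simp: cinfinite_def Field_card_of card_of_card_order_on)
  ultimately show False using not_ordLess_ordLeq by blast
qed

section \<open>Nonstandard numbers\<close>

primrec std :: "nat \<Rightarrow> 'a" where
  "std 0 = zero"
| "std (Suc i) = sc (std i)"

lemma std_W [simp]: "E (std i) W"
  by (induction i) auto

lemma std_less: "i < j \<Longrightarrow> E (std i) (std j)"
  by (induction j) (auto simp: less_Suc_eq)

text \<open>The weak inequality already excludes standard \<open>k\<close>, as no standard number is
  greatest; it is the form in which \<open>no_small_cut\<close> yields bounds.\<close>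

definition nonstd :: "'a \<Rightarrow> bool" where
  "nonstd k \<longleftrightarrow> E k W \<and> (\<forall>i. le (std i) k)"

lemma nonstdI:
  assumes k: "E k W" "k \<notin> range std"
  shows "nonstd k"
proof -
  have "le (std i) k" for i
  proof (induction i)
    case 0
    then show ?case using zero_le k by simp
  next
    case (Suc i)
    then have "E (std i) k" using k unfolding le_def by auto
    then show ?case using sc_le k by simp
  qed
  then show ?thesis using k unfolding nonstd_def by simp
qed

lemma nonstd_not_std:
  assumes "nonstd k"
  shows "k \<noteq> std i"
proof
  assume "k = std i"
  then have "le (std (Suc i)) (std i)" using assms unfolding nonstd_def by blast
  then have "E (std i) (std i)" using lt_le_trans[OF std_W std_less[OF lessI]] by blast
  then show False by simp
qed

text \<open>This leaves room for one more digit below any nonstandard height.\<close>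

lemma nonstd_pred:
  assumes "nonstd k"
  shows "\<exists>j. nonstd j \<and> k = sc j"
proof -
  have "k \<noteq> zero" using nonstd_not_std[OF assms, of 0] by simp
  then obtain j where j: "E j W" "k = sc j" using W_cases assms unfolding nonstd_def by blast
  have "j \<noteq> std i" for i using nonstd_not_std[OF assms, of "Suc i"] j(2) by auto
  then have "j \<notin> range std" by blast
  then show ?thesis using j nonstdI by blast
qed

text \<open>Otherwise \<open>std\<close> would be an order isomorphism from the natural numbers onto
  \<open>omega_hat E\<close>.\<close>

lemma nonstd_ex:
  assumes "omega_nonstandard E"
  shows "\<exists>N. nonstd N"
proof (rule ccontr)
  assume "\<not> ?thesis"
  then have "range std = omega_hat E" using nonstdI in_W std_W by blast
  moreover have less_iff: "i < j \<longleftrightarrow> E (std i) (std j)" for i j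
    using std_less asym irrefl by (metis nat_neq_iff)
  moreover have "inj std" by (metis injI irrefl less_iff nat_neq_iff)
  ultimately show False using assms unfolding omega_nonstandard_def bij_betw_def by blast
qed

end

section \<open>Realizing types\<close>

context digit_tree
begin

text \<open>A pair \<open>v\<close> is a height \<open>fst v\<close> together with a branch \<open>snd v\<close>. The branch
  \<open>snd w\<close> passes through the node of \<open>snd v\<close> at height \<open>fst v\<close>, and below that node all its digits down to height \<open>fst w\<close> satisfy \<open>P\<close>.\<close>

definition refines :: "('a \<Rightarrow> bool) \<Rightarrow> 'a \<times> 'a \<Rightarrow> 'a \<times> 'a \<Rightarrow> bool" where
  "refines P v w \<longleftrightarrow> le (fst w) (fst v) \<and> Q (snd w) (fst v) = Q (snd v) (fst v) \<and>
    (\<forall>j. E j W \<longrightarrow> le (fst w) j \<longrightarrow> E j (fst v) \<longrightarrow> P (d (snd w) j))"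

lemma refines_self: "refines P v v"
  unfolding refines_def using le_not_gt by simp

text \<open>\<open>no_small_cut\<close> is used twice: for a branch \<open>c\<close> through all the
  nodes of the chain, then for a nonstandard height \<open>k\<close> at which to truncate
  it.\<close>

lemma common_refinement:
  fixes D :: "'b set"
  assumes bp: "below_p E I" and inf: "infinite I" and N: "nonstd N"
    and P: "\<And>y. y \<in> D \<Longrightarrow> definable E (\<lambda>s. P y (s 0))"
    and D: "|D| \<le>o |I|"
    and v: "\<And>y. y \<in> D \<Longrightarrow> nonstd (fst (v y)) \<and> E (snd (v y)) W"
    and chain: "\<And>x y. x \<in> D \<Longrightarrow> y \<in> D \<Longrightarrow> refines (P x) (v x) (v y) \<or> refines (P y) (v y) (v x)"
  shows "\<exists>w. nonstd (fst w) \<and> E (snd w) W \<and> (\<forall>y\<in>D. refines (P y) (v y) w)"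
proof (cases "D = {}")
  case True
  then show ?thesis using N zero_W by (intro exI[of _ "(N, zero)"]) simp
next
  case False
  note [dfb] = definable_term_comp2[OF definable_Q] definable_term_comp2[OF definable_d]
  define K where "K y = fst (v y)" for y
  define Z where "Z y = snd (v y)" for y
  have K: "nonstd (K y)" "E (K y) W" and Z: "E (Z y) W" if "y \<in> D" for y
    using v[OF that] unfolding K_def Z_def nonstd_def by auto
  have same: "Q (Z x) (K y) = Q (Z y) (K y) \<or> Q (Z y) (K x) = Q (Z x) (K x)" if "x \<in> D" "y \<in> D" for x y
    using chain[OF that] unfolding refines_def K_def Z_def by auto
  \<comment> \<open>\<open>lo y\<close> and \<open>hi y\<close> will be the ends of the interval of
    numbers passing through the node of \<open>v y\<close>.\<close>
  have "\<exists>a. E a W \<and> Q a (K y) = Q (Z y) (K y) \<and> (\<forall>z. E z W \<longrightarrow> Q z (K y) = Q (Z y) (K y) \<longrightarrow> le a z)"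
    if y: "y \<in> D" for y
    by (rule least_ex[OF _ Z[OF y]], intro dfb, rule refl)
  then obtain lo where lo: "\<And>y. y \<in> D \<Longrightarrow> E (lo y) W" "\<And>y. y \<in> D \<Longrightarrow> Q (lo y) (K y) = Q (Z y) (K y)"
    "\<And>y z. y \<in> D \<Longrightarrow> E z W \<Longrightarrow> Q z (K y) = Q (Z y) (K y) \<Longrightarrow> le (lo y) z" by metis
  have "\<exists>a. E a W \<and> Q a (K y) = Q (Z y) (K y) \<and> (\<forall>z. E z W \<longrightarrow> Q z (K y) = Q (Z y) (K y) \<longrightarrow> le z a)"
    if y: "y \<in> D" for y
  proof -
    obtain b where b: "E b W" "\<And>z. E z W \<Longrightarrow> Q z (K y) = Q (Z y) (K y) \<Longrightarrow> le z b"
      using Q_bounded[OF Z[OF y] K(2)[OF y]] by blast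
    show ?thesis by (rule greatest_ex[OF _ Z[OF y] _ b]) (intro dfb refl | assumption)+
  qed
  then obtain hi where hi: "\<And>y. y \<in> D \<Longrightarrow> E (hi y) W" "\<And>y. y \<in> D \<Longrightarrow> Q (hi y) (K y) = Q (Z y) (K y)"
    "\<And>y z. y \<in> D \<Longrightarrow> E z W \<Longrightarrow> Q z (K y) = Q (Z y) (K y) \<Longrightarrow> le z (hi y)" by metis
  have small: "|f ` D| \<le>o |I|" for f :: "'b \<Rightarrow> 'a"
    by (rule ordLeq_transitive[OF card_of_image D])
  have "\<exists>c. E c W \<and> (\<forall>x\<in>lo ` D. le x c) \<and> (\<forall>y\<in>hi ` D. le c y)"
  proof (rule no_small_cut[OF bp inf _ small _ small])
    fix a b
    assume "a \<in> lo ` D" "b \<in> hi ` D"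
    then obtain x y where xy: "x \<in> D" "y \<in> D" "a = lo x" "b = hi y" by blast
    \<comment> \<open>Any two of the nodes lie on a common branch, either \<open>Z x\<close> or
      \<open>Z y\<close>, so their intervals meet.\<close>
    from same[OF xy(1,2)] have "\<exists>z. E z W \<and> Q z (K x) = Q (Z x) (K x) \<and> Q z (K y) = Q (Z y) (K y)"
      using Z xy by blast
    then obtain z where "E z W" "le (lo x) z" "le z (hi y)" using lo(3) hi(3) xy by blast
    then show "le a b" using le_trans[OF hi(1)] xy by blast
  qed (use lo(1) hi(1) False in auto)
  then obtain c where cW: "E c W" and c': "\<forall>x\<in>lo ` D. le x c" "\<forall>y\<in>hi ` D. le c y" by (elim exE conjE)
  have c: "E c W" "\<And>y. y \<in> D \<Longrightarrow> le (lo y) c" "\<And>y. y \<in> D \<Longrightarrow> le c (hi y)"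
    using cW c' by simp_all
  \<comment> \<open>Between the ends of the interval, monotonicity of \<open>Q\<close> squeezes the
    node of \<open>c\<close> to that of \<open>Z y\<close>.\<close>
  have Qc: "Q c (K y) = Q (Z y) (K y)" if y: "y \<in> D" for y
  proof (rule le_antisym)
    show "le (Q c (K y)) (Q (Z y) (K y))"
      using Q_mono[OF hi(1)[OF y] K(2)[OF y] c(3)[OF y]] hi(2)[OF y] by simp
    show "le (Q (Z y) (K y)) (Q c (K y))"
      using Q_mono[OF c(1) K(2)[OF y] c(2)[OF y]] lo(2)[OF y] by simp
  qed
  define ok where "ok y m \<longleftrightarrow> (\<forall>j. E j W \<longrightarrow> le m j \<longrightarrow> E j (K y) \<longrightarrow> P y (d c j))" for y m
  \<comment> \<open>\<open>m y\<close> is the least height down to which the digits of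
    \<open>c\<close> satisfy \<open>P y\<close>; at \<open>K y\<close> the condition is
    vacuous.\<close>
  have "\<exists>m. E m W \<and> ok y m \<and> (\<forall>k. E k W \<longrightarrow> ok y k \<longrightarrow> le m k)" if y: "y \<in> D" for y
  proof (rule least_ex[OF _ K(2)[OF y]])
    have "definable_term E (\<lambda>s. d c (s 0))" by (intro dfb)
    then have "definable E (\<lambda>s. P y (d c (s 0)))"
      by (rule definable_let[where P="\<lambda>x s. P y x"]) (rule P[OF y])
    note [dfb] = this
    show "definable E (\<lambda>s. ok y (s 0))" unfolding ok_def by (intro dfb)
    show "ok y (K y)" unfolding ok_def using le_not_gt by simp
  qed
  then obtain m where m: "\<And>y. y \<in> D \<Longrightarrow> E (m y) W" "\<And>y. y \<in> D \<Longrightarrow> ok y (m y)"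
    "\<And>y k. y \<in> D \<Longrightarrow> E k W \<Longrightarrow> ok y k \<Longrightarrow> le (m y) k" by metis
  have "|range std| \<le>o |I|"
    by (rule ordLeq_transitive[OF card_of_image infinite_iff_card_of_nat[THEN iffD1, OF inf]])
  then have small': "|m ` D \<union> range std| \<le>o |I|"
    using inf small card_of_Card_order
    by (intro card_of_Un_ordLeq_infinite_Field) (simp_all add: Field_card_of)
  \<comment> \<open>Adding the standard numbers to the lower side forces \<open>k\<close> to be
    nonstandard.\<close>
  have "\<exists>k. E k W \<and> (\<forall>x\<in>m ` D \<union> range std. le x k) \<and> (\<forall>y\<in>K ` D. le k y)"
  proof (rule no_small_cut[OF bp inf _ small' _ small])
    fix a b
    assume "a \<in> m ` D \<union> range std" "b \<in> K ` D"
    then obtain y where y: "y \<in> D" "b = K y" and a: "a \<in> m ` D \<or> a \<in> range std" by blast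
    from a show "le a b"
    proof
      assume "a \<in> range std"
      then show ?thesis using K(1)[OF y(1)] y(2) unfolding nonstd_def by blast
    next
      assume "a \<in> m ` D"
      then obtain x where x: "x \<in> D" "a = m x" by blast
      from chain[OF x(1) y(1)] show ?thesis
      proof
        assume r: "refines (P x) (v x) (v y)"
        \<comment> \<open>From height \<open>K y\<close> upwards the digits of \<open>c\<close> are
          those of \<open>Z y\<close>, which satisfy \<open>P x\<close> below \<open>K x\<close>.
          Hence \<open>m x\<close> is at most \<open>K y\<close>.\<close>
        have "ok x (K y)"
          unfolding ok_def
        proof (intro allI impI)
          fix j
          assume j: "E j W" "le (K y) j" "E j (K x)"
          have "d c j = d (Z y) j" using Q_agree[OF j(1,2) Qc[OF y(1)]] by simp
          then show "P x (d c j)" using r j unfolding refines_def K_def Z_def by simp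
        qed
        then show ?thesis using m(3)[OF x(1) K(2)[OF y(1)]] x y by blast
      next
        assume "refines (P y) (v y) (v x)"
        then have "le (K x) (K y)" unfolding refines_def K_def by simp
        moreover have "le (m x) (K x)"
          using m(3)[OF x(1) K(2)[OF x(1)]] le_not_gt unfolding ok_def by simp
        ultimately show ?thesis using le_trans[OF K(2)[OF y(1)]] x y by blast
      qed
    qed
  qed (use m(1) K(2) False in auto)
  then obtain k where kW: "E k W" and k': "\<forall>x\<in>m ` D \<union> range std. le x k" "\<forall>y\<in>K ` D. le k y"
    by (elim exE conjE)
  have k: "E k W" "\<And>y. y \<in> D \<Longrightarrow> le (m y) k" "\<And>i. le (std i) k" "\<And>y. y \<in> D \<Longrightarrow> le k (K y)"
    using kW k' by simp_all
  have "refines (P y) (v y) (k, c)" if y: "y \<in> D" for y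
    unfolding refines_def K_def[symmetric] Z_def[symmetric] fst_conv snd_conv
  proof (intro conjI allI impI k(4)[OF y] Qc[OF y])
    fix j
    assume j: "E j W" "le k j" "E j (K y)"
    then have "le (m y) j" using le_trans[OF j(1) k(2)[OF y]] by blast
    then show "P y (d c j)" using m(2)[OF y] j unfolding ok_def by blast
  qed
  then show ?thesis using k(1,3) c(1) unfolding nonstd_def by (intro exI[of _ "(k, c)"]) simp
qed

text \<open>The induction is on \<open>|J|\<close>: proper initial segments of the well-order
  \<open>|J|\<close> have smaller cardinality, so for each \<open>x\<close> some \<open>e x\<close>
  realizes everything before \<open>x\<close>. These elements become the digits of the
  chain.\<close>

lemma realize_small_type:
  fixes I :: "'i set" and A :: "'i \<Rightarrow> 'a \<Rightarrow> bool"
  assumes bp: "below_p E I" and N: "nonstd N"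
    and A: "\<And>i. i \<in> I \<Longrightarrow> definable E (\<lambda>s. A i (s 0))"
    and fin: "\<And>F. F \<subseteq> I \<Longrightarrow> finite F \<Longrightarrow> \<exists>x. E x n \<and> (\<forall>i\<in>F. A i x)"
  shows "J \<subseteq> I \<Longrightarrow> \<exists>x. E x n \<and> (\<forall>i\<in>J. A i x)"
proof (induction J rule: wf_induct_rule[OF wf_inv_image[OF wf_ordLess, of "card_of :: 'i set \<Rightarrow> 'i rel"]])
  case (1 J)
  show ?case
  proof (cases "finite J")
    case True
    then show ?thesis using fin 1 by blast
  next
    case False
    let ?r = "|J|"
    have F: "Field ?r = J" by (rule Field_card_of)
    have inf: "infinite I" using False 1 finite_subset by blast
    have small: "|D| \<le>o |I|" if "D \<subseteq> J" for D using that 1 card_of_mono1 by (meson order_trans)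
    have wf: "wf (?r - Id)" and To: "total_on J ?r"
      using card_of_Well_order[of J] F unfolding well_order_on_def linear_order_on_def by simp_all
    have sub: "underS ?r x \<subseteq> J" for x using F unfolding underS_def Field_def by auto
    have IH: "\<exists>e. E e n \<and> (\<forall>i\<in>K. A i e)" if "|K| <o |J|" "K \<subseteq> I" for K
      using 1(1)[of K] that by simp
    have "\<exists>e. E e n \<and> (\<forall>y\<in>underS ?r x. A y e)" if x: "x \<in> J" for x
    proof (rule IH)
      show "|underS ?r x| <o ?r" by (rule card_of_underS[OF card_of_Card_order]) (simp add: F x)
      show "underS ?r x \<subseteq> I" using sub 1(2) by blast
    qed
    then have "\<forall>x\<in>J. \<exists>e. E e n \<and> (\<forall>y\<in>underS ?r x. A y e)" by (rule ballI)
    from bchoice[OF this] obtain e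
      where e: "\<forall>x\<in>J. E (e x) n \<and> (\<forall>y\<in>underS ?r x. A y (e x))" by (elim exE)
    \<comment> \<open>The heights must descend strictly, so that the digit at the height of
      \<open>f x\<close> is among those tested for each earlier \<open>y\<close>.\<close>
    define good where "good f x w \<longleftrightarrow> nonstd (fst w) \<and> E (snd w) W \<and>
      (\<forall>y\<in>underS ?r x. refines (A y) (f y) w \<and> E (fst w) (fst (f y)))"
      for f :: "'i \<Rightarrow> 'a \<times> 'a" and x w
    have extend: "\<exists>w. nonstd (fst w) \<and> E (snd w) W \<and> (\<forall>y\<in>D. refines (A y) (f y) w)"
      if D: "D \<subseteq> J" and f: "\<And>x. x \<in> D \<Longrightarrow> good f x (f x)" for D f
    proof (rule common_refinement[OF bp inf N _ small[OF D]])
      fix x y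
      assume xy: "x \<in> D" "y \<in> D"
      then consider "x = y" | "x \<in> underS ?r y" | "y \<in> underS ?r x"
        using To D unfolding total_on_def underS_def by blast
      then show "refines (A x) (f x) (f y) \<or> refines (A y) (f y) (f x)"
      proof cases
        case 1
        then show ?thesis using refines_self by simp
      next
        case 2
        then show ?thesis using f[OF xy(2)] unfolding good_def by blast
      next
        case 3
        then show ?thesis using f[OF xy(1)] unfolding good_def by blast
      qed
    next
      show "definable E (\<lambda>s. A y (s 0))" if "y \<in> D" for y using A D 1(2) that by blast
      show "nonstd (fst (f y)) \<and> E (snd (f y)) W" if "y \<in> D" for y
        using f[OF that] unfolding good_def by blast
    qed
    have step: "\<exists>w. good f x w" if x: "x \<in> J" and f: "\<And>y. y \<in> underS ?r x \<Longrightarrow> good f y (f y)" for f x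
    proof -
      obtain w where w: "nonstd (fst w)" "E (snd w) W" "\<forall>y\<in>underS ?r x. refines (A y) (f y) w"
        using extend[OF sub f] by blast
      \<comment> \<open>One height is spent: the new branch keeps the node of \<open>w\<close> at
        height \<open>sc k\<close> and takes \<open>e x\<close> as its digit at \<open>k\<close>,
        which suits all \<open>y\<close> before \<open>x\<close>.\<close>
      obtain k where k: "nonstd k" "fst w = sc k" using nonstd_pred[OF w(1)] by blast
      have kW: "E k W" using k(1) unfolding nonstd_def by blast
      have ex: "E (e x) n" using e x by blast
      obtain z where z: "E z W" "Q z (sc k) = Q (snd w) (sc k)" "d z k = e x"
        using Q_extend[OF w(2) kW ex] by blast
      have "refines (A y) (f y) (k, z) \<and> E k (fst (f y))" if y: "y \<in> underS ?r x" for y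
      proof -
        have r: "le (sc k) (fst (f y))" "Q (snd w) (fst (f y)) = Q (snd (f y)) (fst (f y))"
          "\<And>j. E j W \<Longrightarrow> le (sc k) j \<Longrightarrow> E j (fst (f y)) \<Longrightarrow> A y (d (snd w) j)"
          using bspec[OF w(3) y] k(2) unfolding refines_def by simp_all
        have fy: "E (fst (f y)) W" using f[OF y] unfolding good_def nonstd_def by blast
        have lt: "E k (fst (f y))" using lt_le_trans[OF fy _ r(1), of k] by simp
        have "A y (d z j)" if j: "E j W" "le k j" "E j (fst (f y))" for j
        proof (cases "j = k")
          case True
          then show ?thesis using z(3) e x y by simp
        next
          case False
          then have "le (sc k) j" using j sc_le unfolding le_def by blast
          then show ?thesis using r(3)[OF j(1) _ j(3)] Q_agree[OF j(1) _ z(2)] by simp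
        qed
        moreover have "Q z (fst (f y)) = Q (snd (f y)) (fst (f y))"
          using r(2) Q_agree[OF fy r(1) z(2)] by simp
        moreover have "le k (fst (f y))" using lt unfolding le_def by simp
        ultimately show ?thesis using lt unfolding refines_def by simp
      qed
      then show ?thesis using k(1) z(1) unfolding good_def by (intro exI[of _ "(k, z)"]) simp
    qed
    have "\<exists>f. \<forall>x. x \<in> J \<longrightarrow> good f x (f x)"
    proof (rule dependent_wf_choice[OF wf])
      show "(x \<in> J \<longrightarrow> good f x w) = (x \<in> J \<longrightarrow> good g x w)"
        if "\<And>z. (z, x) \<in> ?r - Id \<Longrightarrow> f z = g z" for f g x w
      proof -
        have "f y = g y" if "y \<in> underS ?r x" for y
          using \<open>\<And>z. (z, x) \<in> ?r - Id \<Longrightarrow> f z = g z\<close>[of y] that unfolding underS_def by simp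
        then show ?thesis unfolding good_def by simp
      qed
    next
      fix x f
      assume f: "y \<in> J \<longrightarrow> good f y (f y)" if "(y, x) \<in> ?r - Id" for y
      have "good f y (f y)" if "y \<in> underS ?r x" for y
        using f[of y] sub that unfolding underS_def by blast
      then show "\<exists>w. x \<in> J \<longrightarrow> good f x w" using step by blast
    qed
    then obtain f where f: "\<And>x. x \<in> J \<Longrightarrow> good f x (f x)" by blast
    obtain w where w: "nonstd (fst w)" "E (snd w) W" "\<forall>y\<in>J. refines (A y) (f y) w"
      using extend[OF subset_refl f] by blast
    have wW: "E (fst w) W" using w(1) unfolding nonstd_def by blast
    have "A y (d (snd w) (fst w))" if y: "y \<in> J" for y
    proof -
      \<comment> \<open>An infinite cardinal has no last element. The height of a later
        \<open>x\<close> lies strictly below that of \<open>y\<close> and bounds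
        \<open>fst w\<close>, so the digit of \<open>w\<close> at \<open>fst w\<close> is tested for
        \<open>y\<close>.\<close>
      obtain x where x: "x \<in> J" "y \<noteq> x" "(y, x) \<in> ?r"
        using infinite_Card_order_limit[OF card_of_Card_order, of J y] F False y by auto
      then have "E (fst (f x)) (fst (f y))" using f[OF x(1)] unfolding good_def underS_def by blast
      moreover have "E (fst (f y)) W" using f[OF y] unfolding good_def nonstd_def by blast
      moreover have "le (fst w) (fst (f x))" using w(3) x(1) unfolding refines_def by blast
      ultimately have "E (fst w) (fst (f y))" using le_lt_trans by blast
      then show ?thesis using bspec[OF w(3) y] wW unfolding refines_def by simp
    qed
    moreover have "E (d (snd w) (fst w)) n" using d_less w(2) wW by blast
    ultimately show ?thesis by blast
  qed
qed

end

section \<open>Reduction of the internally finite set to a number\<close>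

lemma definable_sat: "definable E (\<lambda>s. sat E (\<lambda>i. if i = 0 then s 0 else c) \<phi>)"
proof (rule definableI)
  show "sat E (\<lambda>i. if i = 0 then s 0 else c) \<phi> \<longleftrightarrow>
      sat E (\<lambda>i. weave s (\<lambda>_. c) (if i = 0 then 0 else 1)) \<phi>" for s
    by (rule sat_cong) (simp add: weave_def)
qed

theorem mainTheorem3:
  fixes E :: "'a \<Rightarrow> 'a \<Rightarrow> bool"
    and I :: "'i set" and i0 :: 'i
    and \<phi> :: "'i \<Rightarrow> form" and a :: "'i \<Rightarrow> 'a" and X :: 'a
  assumes "ZFC_minus E"
    and "omega_nonstandard E"
    and "below_p E I"
    and "i0 \<in> I"
    and "\<And>F. F \<subseteq> I \<Longrightarrow> finite F \<Longrightarrow>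
           \<exists>x. \<forall>\<alpha>\<in>F. sat E (\<lambda>n. if n = 0 then x else a \<alpha>) (\<phi> \<alpha>)"
    and "internally_finite E X"
    and "\<phi> i0 = Mem 0 1" and "a i0 = X"
  shows "\<exists>x. \<forall>\<alpha>\<in>I. sat E (\<lambda>n. if n = 0 then x else a \<alpha>) (\<phi> \<alpha>)"
proof -
  interpret zfc_minus_model E by unfold_locales (rule assms(1))
  let ?S = "\<lambda>\<alpha> x. sat E (\<lambda>n. if n = 0 then x else a \<alpha>) (\<phi> \<alpha>)"
  obtain n f where n: "E n W" and f: "internal_bij E f n X"
    using assms(6) unfolding internally_finite_def in_W by blast
  have f_dom: "E u n" if uv: "rel_of E f u v" for u v
  proof -
    obtain p where p: "E p f" "is_pair E p u v" using uv unfolding rel_of_def by blast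
    then obtain u' v' where "E u' n" "is_pair E p u' v'" using f unfolding internal_bij_def by blast
    then show ?thesis using pair_inj p(2) by blast
  qed
  have f_fun: "v = v'" if "rel_of E f u v" "rel_of E f u v'" for u v v'
    using f that unfolding internal_bij_def by blast
  have f_onto: "\<exists>u. rel_of E f u v" if "E v X" for v
    using f that unfolding internal_bij_def by blast
  \<comment> \<open>The type is transported from \<open>X\<close> to \<open>n\<close> along the
    internal bijection \<open>f\<close>.\<close>
  define A where "A \<alpha> u \<longleftrightarrow> (\<exists>x. rel_of E f u x \<and> ?S \<alpha> x)" for \<alpha> u
  have dA: "definable E (\<lambda>s. A \<alpha> (s 0))" for \<alpha>
    unfolding A_def by (intro dfb definable_sat)
  have fin: "\<exists>u. E u n \<and> (\<forall>\<alpha>\<in>F. A \<alpha> u)" if F: "F \<subseteq> I" "finite F" for F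
  proof -
    \<comment> \<open>Including \<open>i0\<close> puts the witness into \<open>X\<close>, where it
      has a preimage below \<open>n\<close>.\<close>
    obtain x where x: "\<forall>\<alpha>\<in>insert i0 F. ?S \<alpha> x" using assms(5)[of "insert i0 F"] F assms(4) by blast
    then have "E x X" using assms(7,8) by simp
    then obtain u where "rel_of E f u x" using f_onto by blast
    then show ?thesis using x f_dom unfolding A_def by blast
  qed
  have "n \<noteq> zero" using fin[of "{}"] by auto
  then have "E zero n" using zero_le[OF n] unfolding le_def by blast
  then obtain Q d where "digit_tree E n Q d" using digit_tree_ex[OF n] by blast
  then interpret digit_tree E n Q d .
  obtain N where N: "nonstd N" using nonstd_ex[OF assms(2)] by blast
  obtain u where u: "\<And>\<alpha>. \<alpha> \<in> I \<Longrightarrow> A \<alpha> u"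
    using realize_small_type[OF assms(3) N dA fin subset_refl] by blast
  \<comment> \<open>The index \<open>i0\<close> supplies an image \<open>x\<close> of
    \<open>u\<close>; since \<open>f\<close> is single-valued, the same \<open>x\<close> serves
    every formula.\<close>
  then obtain x where x: "rel_of E f u x" using assms(4) unfolding A_def by blast
  then have "?S \<alpha> x" if "\<alpha> \<in> I" for \<alpha> using u[OF that] f_fun unfolding A_def by blast
  then show ?thesis by blast
qed

end
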